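(* The reductive homogeneous space $W^{\mathrm{ir}}=\mathbb{R}\times(\mathrm{SL}(2,\mathbb{R})\ltimes\mathbb{R}^2)/H_\mu$ with the metrics $g_{\alpha\beta\gamma}$ ($\alpha,\beta,\gamma>0$) and its $\mathrm{SO}(3)_{\mathrm{ir}}$ structure has the following properties: (1) For any $\beta>0$ and parameters $\alpha,\gamma>0$ satisfying $\alpha\ge12\gamma$, the $\mathrm{SO}(3)_{\mathrm{ir}}$ structure is nearly integrable for the two embeddings of the isotropy group $H_\mu$ defined by $$\mu=\frac{\sqrt\alpha\pm\sqrt{\alpha-12\gamma}}{2\sqrt{3\gamma}},$$ and the torsion $T^{\alpha\beta\gamma}$ of its characteristic connection $\nabla^{\alpha\beta\gamma}$ is, in the orthonormal basis $e_1,\dots,e_5$ of $\mathfrak m$, given by $$T^{\alpha\beta\gamma}=-\frac{2\sqrt3}{\sqrt\gamma}\,(e_1\wedge e_2\wedge e_3+e_1\wedge e_4\wedge e_5).$$ The holonomy of $\nabla^{\alpha\beta\gamma}$ is $\mathrm{SO}(3)_{\mathrm{ir}}\subset\mathrm{SO}(5)$. Its torsion is not parallel, $\nabla^{\alpha\beta\gamma}T^{\alpha\beta\gamma}\ne0$, but it is divergence-free, $\delta T^{\alpha\beta\gamma}=0$. (2) The metric of the nearly integrable $\mathrm{SO}(3)_{\mathrm{ir}}$ structure is never naturally reductive and never Einstein.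
   Context: General notation. $E_{ij}$ is the endomorphism of $\mathbb{R}^5$ sending $e_i$ to $e_j$, $e_j$ to $-e_i$ and all other basis vectors to zero. $\mathrm{SO}(3)_{\mathrm{ir}}\subset\mathrm{SO}(5)$ is the image of the irreducible $5$-dimensional representation of $\mathrm{SO}(3)$, well defined up to conjugation in $\mathrm{SO}(5)$. For the present space it is realized as the connected subgroup of $\mathrm{SO}(5)$ with Lie algebra spanned by $$Y_1=-\sqrt3E_{12}+E_{35}+E_{24},\quad Y_2=-\sqrt3E_{13}+E_{25}-E_{34},\quad Y_3=E_{23}+2E_{45}.$$ Up to scale there is a unique nonzero symmetric trilinear form on $\mathbb{R}^5$ invariant under this group; let $\Upsilon$ be such a form, normalized so that $\Upsilon_v^2v=g(v,v)v$, where $g(\Upsilon_vu,w)=\Upsilon(v,u,w)$. An $\mathrm{SO}(3)_{\mathrm{ir}}$ structure on a Riemannian $5$-manifold $(M,g)$ is a reduction of its orthonormal frame bundle to $\mathrm{SO}(3)_{\mathrm{ir}}$; it determines a tensor field $\Upsilon$ on $M$. It is nearly integrable if $(\nabla^g_v\Upsilon)(v,v,v)=0$ for all vector fields $v$, $\nabla^g$ being the Levi-Civita connection. A characteristic connection is a metric connection preserving the $\mathrm{SO}(3)_{\mathrm{ir}}$ structure whose torsion, viewed as $T(X,Y,Z)=g(T(X,Y),Z)$, is totally skew-symmetric. $\delta T=-\sum_ie_i\lrcorner\nabla^g_{e_i}T$ is the divergence. The space. Let $G=\mathbb{R}\times(\mathrm{SL}(2,\mathbb{R})\ltimes\mathbb{R}^2)$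 with Lie algebra $\mathfrak g=\mathbb{R}\oplus(\mathfrak{sl}(2,\mathbb{R})\ltimes\mathbb{R}^2)$ ($\mathfrak{sl}(2,\mathbb{R})$ acting on the abelian ideal $\mathbb{R}^2$ by the standard representation), and let $X=\begin{bmatrix}1&0\\0&-1\end{bmatrix}$, $E_+=\begin{bmatrix}0&1\\0&0\end{bmatrix}$, $E_-=\begin{bmatrix}0&0\\1&0\end{bmatrix}$. For $\mu\in\mathbb{R}$ put (numbers denoting elements of the summand $\mathbb{R}$ of $\mathfrak g$) $$\bar e_0^\mu=E_+-E_-+\mu,\ \ \bar e_1^\mu=1-\mu(E_+-E_-),\ \ \bar e_2=(0,1)^t,\ \ \bar e_3=(1,0)^t,\ \ \bar e_4=E_++E_-,\ \ \bar e_5=X .$$ $H_\mu$ is the one-parameter subgroup of $G$ generated by $\bar e_0^\mu$, with Lie algebra $\mathfrak h_\mu$, and $W^{\mathrm{ir}}=G/H_\mu$. The isotropy representation on $\mathfrak m=\mathrm{span}(\bar e_1^\mu,\bar e_2,\dots,\bar e_5)$, a reductive complement of $\mathfrak h_\mu$ in $\mathfrak g$, is given by $\lambda(\bar e_0^\mu)=E_{23}+2E_{45}$, so it takes values in $\mathrm{SO}(2)_{\mathrm{ir}}=\{\mathrm{diag}(1,A,A^2):A\in\mathrm{SO}(2)\}$. The $G$-invariant metric $g_{\alpha\beta\gamma}$ is given on $\mathfrak m$ by $\mathrm{diag}(\alpha,\beta,\beta,\gamma,\gamma)$ in the basis $\bar e_1^\mu,\bar e_2,\dots,\bar e_5$,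 with orthonormal basis $e_1=\bar e_1^\mu/\sqrt\alpha$, $e_2=\bar e_2/\sqrt\beta$, $e_3=\bar e_3/\sqrt\beta$, $e_4=\bar e_4/\sqrt\gamma$, $e_5=\bar e_5/\sqrt\gamma$, identified with its dual basis. The $\mathrm{SO}(3)_{\mathrm{ir}}$ structure on $(W^{\mathrm{ir}},g_{\alpha\beta\gamma})$ is the $G$-invariant one for which $(e_1,\dots,e_5)$ is an adapted frame at the base point. Invariant tensors on $G/H_\mu$ are identified with invariant tensors on $\mathfrak m$. Naturally reductive means with respect to the decomposition $\mathfrak g=\mathfrak h_\mu\oplus\mathfrak m$, i.e. $g([X,Y]_{\mathfrak m},Z)$ is skew-symmetric in $X,Y,Z\in\mathfrak m$. *)

theory Defs
  imports "HOL-Analysis.Analysis"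
begin

section \<open>The group \<open>SO(3)\<^sub>i\<^sub>r\<close> and the tensor \<open>\<Upsilon>\<close>\<close>

definition Eij :: "5 \<Rightarrow> 5 \<Rightarrow> real^5^5" where
  "Eij i j = (\<chi> a b. if a = j \<and> b = i then 1 else if a = i \<and> b = j then -1 else 0)"

lemma Eij_axis:
  assumes "i \<noteq> j"
  shows "Eij i j *v axis i 1 = axis j 1" "Eij i j *v axis j 1 = - axis i 1"
    "k \<noteq> i \<Longrightarrow> k \<noteq> j \<Longrightarrow> Eij i j *v axis k 1 = 0"
  using assms unfolding matrix_vector_mult_basis column_def
  by (auto simp: vec_eq_iff Eij_def axis_def)

definition Y1 :: "real^5^5" where "Y1 = - sqrt 3 *\<^sub>R Eij 1 2 + Eij 3 5 + Eij 2 4"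
definition Y2 :: "real^5^5" where "Y2 = - sqrt 3 *\<^sub>R Eij 1 3 + Eij 2 5 - Eij 3 4"
definition Y3 :: "real^5^5" where "Y3 = Eij 2 3 + 2 *\<^sub>R Eij 4 5"

definition so3_ir :: "(real^5^5) set" where "so3_ir = span {Y1, Y2, Y3}"

text \<open>\<open>c\<close> is the one-parameter subgroup \<open>t \<mapsto> exp (t \<xi>)\<close> of a group with multiplication \<open>mul\<close> and
  unit \<open>one\<close> that is contained in a vector space.\<close>
definition one_parameter_subgroup ::
  "('a \<Rightarrow> 'a \<Rightarrow> 'a) \<Rightarrow> 'a \<Rightarrow> 'a::real_normed_vector \<Rightarrow> (real \<Rightarrow> 'a) \<Rightarrow> bool" where
  "one_parameter_subgroup mul one \<xi> c \<longleftrightarrow>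
     c 0 = one \<and> (\<forall>s t. c (s + t) = mul (c s) (c t)) \<and> (c has_vector_derivative \<xi>) (at 0)"

text \<open>The connected Lie subgroup with Lie algebra \<open>so3_ir\<close>, i.e. the subgroup generated by
  \<open>exp so3_ir\<close>.\<close>
inductive_set SO3_ir :: "(real^5^5) set" where
  one: "mat 1 \<in> SO3_ir"
| mult: "A \<in> SO3_ir \<Longrightarrow> Y \<in> so3_ir \<Longrightarrow> one_parameter_subgroup (**) (mat 1) Y c
         \<Longrightarrow> A ** c t \<in> SO3_ir"

type_synonym tensor3 = "real^5 \<Rightarrow> real^5 \<Rightarrow> real^5 \<Rightarrow> real"

definition contract :: "tensor3 \<Rightarrow> real^5 \<Rightarrow> real^5 \<Rightarrow> real^5" where
  "contract S v u = (\<chi> i. S v u (axis i 1))"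

lemma contract_inner:
  assumes "linear (S v u)"
  shows "contract S v u \<bullet> w = S v u w"
proof -
  have "S v u w = S v u (\<Sum>i\<in>UNIV. w $ i *\<^sub>R axis i 1)"
    by (simp add: basis_expansion scalar_mult_eq_scaleR[symmetric])
  also have "\<dots> = (\<Sum>i\<in>UNIV. w $ i * S v u (axis i 1))"
    using assms by (simp add: linear_sum linear_scale)
  finally show ?thesis
    by (simp add: contract_def inner_vec_def mult.commute)
qed

definition is_Upsilon :: "tensor3 \<Rightarrow> bool" where
  "is_Upsilon U \<longleftrightarrow>
     (\<forall>u w. linear (\<lambda>v. U v u w)) \<and>
     (\<forall>v u w. U v u w = U u v w \<and> U v u w = U v w u) \<and>
     (\<forall>A\<in>SO3_ir. \<forall>v u w. U (A *v v) (A *v u) (A *v w) = U v u w) \<and>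
     (\<forall>v. contract U v (contract U v v) = (v \<bullet> v) *\<^sub>R v)"

text \<open>The normalization determines the form up to sign.\<close>
definition Upsilon :: tensor3 where
  "Upsilon = (SOME U. is_Upsilon U)"


section \<open>The group \<open>G\<close>, its Lie algebra and the subgroup \<open>H\<^sub>\<mu>\<close>\<close>

text \<open>\<open>G\<close> and its Lie algebra both live in the vector space \<open>\<real> \<times> \<real>\<^sup>2\<^sup>\<times>\<^sup>2 \<times> \<real>\<^sup>2\<close>.\<close>
type_synonym amb = "real \<times> (real^2^2) \<times> (real^2)"

definition G_carrier :: "amb set" where
  "G_carrier = {(r, A, v). det A = 1}"

definition G_one :: amb where
  "G_one = (0, mat 1, 0)"

fun G_mult :: "amb \<Rightarrow> amb \<Rightarrow> amb" where
  "G_mult (r, A, v) (s, B, w) = (r + s, A ** B, v + A *v w)"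

definition G_lie :: "amb set" where
  "G_lie = {(s, B, w). trace B = 0}"

fun lie_bracket :: "amb \<Rightarrow> amb \<Rightarrow> amb" where
  "lie_bracket (r, A, v) (s, B, w) = (0, A ** B - B ** A, A *v w - B *v v)"

text \<open>The derivative at the unit of left translation by a group element.\<close>
fun left_trans :: "amb \<Rightarrow> amb \<Rightarrow> amb" where
  "left_trans (r, A, v) (s, B, w) = (s, A ** B, A *v w)"

text \<open>The derivative at the unit of \<open>x \<mapsto> g x g\<^sup>-\<^sup>1\<close>; here \<open>(r, A, v)\<^sup>-\<^sup>1 = (-r, A\<^sup>-\<^sup>1, -A\<^sup>-\<^sup>1 v)\<close>.\<close>
fun Ad :: "amb \<Rightarrow> amb \<Rightarrow> amb" where
  "Ad (r, A, v) (s, B, w) =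
     (s, A ** B ** matrix_inv A, A *v w - (A ** B ** matrix_inv A) *v v)"

definition X_mat :: "real^2^2" where "X_mat = vector [vector [1, 0], vector [0, -1]]"
definition Eplus :: "real^2^2" where "Eplus = vector [vector [0, 1], vector [0, 0]]"
definition Eminus :: "real^2^2" where "Eminus = vector [vector [0, 0], vector [1, 0]]"

definition ebar0 :: "real \<Rightarrow> amb" where "ebar0 \<mu> = (\<mu>, Eplus - Eminus, 0)"
definition ebar1 :: "real \<Rightarrow> amb" where "ebar1 \<mu> = (1, - \<mu> *\<^sub>R (Eplus - Eminus), 0)"
definition ebar2 :: amb where "ebar2 = (0, 0, vector [0, 1])"
definition ebar3 :: amb where "ebar3 = (0, 0, vector [1, 0])"
definition ebar4 :: amb where "ebar4 = (0, Eplus + Eminus, 0)"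
definition ebar5 :: amb where "ebar5 = (0, X_mat, 0)"

definition H_mu :: "real \<Rightarrow> amb set" where
  "H_mu \<mu> = {c t | c t. one_parameter_subgroup G_mult G_one (ebar0 \<mu>) c}"


section \<open>The complement \<open>\<mm>\<close>, the metric and the isotropy representation\<close>

text \<open>\<open>frame \<mu> \<alpha> \<beta> \<gamma> x\<close> is the vector of \<open>\<mm>\<close> with coordinates \<open>x\<close> in the orthonormal basis
  \<open>e\<^sub>1, \<dots>, e\<^sub>5\<close>. All tensors on \<open>\<mm>\<close> are written in these coordinates, so that \<open>\<mm>\<close> becomes
  \<open>real^5\<close>, the metric becomes the standard inner product (lemma \<open>metric_frame\<close>), and the
  invariant \<open>SO(3)\<^sub>i\<^sub>r\<close> structure for which \<open>e\<^sub>1, \<dots>, e\<^sub>5\<close> is adapted has the structure group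
  \<open>SO3_ir\<close> and the tensor \<open>Upsilon\<close>. For \<open>\<alpha> = \<beta> = \<gamma> = 1\<close> the coordinates are those in the
  basis of the \<open>ebar\<close>'s.\<close>
definition frame :: "real \<Rightarrow> real \<Rightarrow> real \<Rightarrow> real \<Rightarrow> real^5 \<Rightarrow> amb" where
  "frame \<mu> \<alpha> \<beta> \<gamma> x =
     x $ 1 *\<^sub>R (ebar1 \<mu> /\<^sub>R sqrt \<alpha>) + x $ 2 *\<^sub>R (ebar2 /\<^sub>R sqrt \<beta>) + x $ 3 *\<^sub>R (ebar3 /\<^sub>R sqrt \<beta>)
     + x $ 4 *\<^sub>R (ebar4 /\<^sub>R sqrt \<gamma>) + x $ 5 *\<^sub>R (ebar5 /\<^sub>R sqrt \<gamma>)"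

definition h_coord :: "real \<Rightarrow> real \<Rightarrow> real \<Rightarrow> real \<Rightarrow> amb \<Rightarrow> real" where
  "h_coord \<mu> \<alpha> \<beta> \<gamma> \<xi> = (THE t. \<exists>x. \<xi> = t *\<^sub>R ebar0 \<mu> + frame \<mu> \<alpha> \<beta> \<gamma> x)"

definition m_coord :: "real \<Rightarrow> real \<Rightarrow> real \<Rightarrow> real \<Rightarrow> amb \<Rightarrow> real^5" where
  "m_coord \<mu> \<alpha> \<beta> \<gamma> \<xi> = (THE x. \<exists>t. \<xi> = t *\<^sub>R ebar0 \<mu> + frame \<mu> \<alpha> \<beta> \<gamma> x)"

definition metric :: "real \<Rightarrow> real \<Rightarrow> real \<Rightarrow> real \<Rightarrow> amb \<Rightarrow> amb \<Rightarrow> real" where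
  "metric \<mu> \<alpha> \<beta> \<gamma> X Y =
     (let x = m_coord \<mu> 1 1 1 X; y = m_coord \<mu> 1 1 1 Y
      in \<alpha> * (x $ 1 * y $ 1) + \<beta> * (x $ 2 * y $ 2) + \<beta> * (x $ 3 * y $ 3)
         + \<gamma> * (x $ 4 * y $ 4) + \<gamma> * (x $ 5 * y $ 5))"

lemma exhaust_5:
  fixes i :: 5
  shows "i = 1 \<or> i = 2 \<or> i = 3 \<or> i = 4 \<or> i = 5"
proof (induct i)
  case (of_int z)
  then have "0 \<le> z" and "z < 5" by simp_all
  then have "z = 0 \<or> z = 1 \<or> z = 2 \<or> z = 3 \<or> z = 4" by arith
  then show ?case by auto
qed

lemma forall_5: "(\<forall>i::5. P i) \<longleftrightarrow> P 1 \<and> P 2 \<and> P 3 \<and> P 4 \<and> P 5"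
  by (metis exhaust_5)

lemma sum_5: "sum f (UNIV::5 set) = f 1 + f 2 + f 3 + f 4 + f 5"
proof -
  have U: "UNIV = {1, 2, 3, 4, 5::5}"
    using exhaust_5 by auto
  show ?thesis unfolding U by (simp add: ac_simps)
qed

lemma decomp_iff:
  assumes "\<alpha> > 0" "\<beta> > 0" "\<gamma> > 0" "(s, B, w) \<in> G_lie"
  shows "(s, B, w) = t *\<^sub>R ebar0 \<mu> + frame \<mu> \<alpha> \<beta> \<gamma> x \<longleftrightarrow>
    t = ((B $ 1 $ 2 - B $ 2 $ 1) / 2 + \<mu> * s) / (1 + \<mu>\<^sup>2) \<and>
    x $ 1 = sqrt \<alpha> * (s - \<mu> * (B $ 1 $ 2 - B $ 2 $ 1) / 2) / (1 + \<mu>\<^sup>2) \<and>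
    x $ 2 = sqrt \<beta> * w $ 2 \<and> x $ 3 = sqrt \<beta> * w $ 1 \<and>
    x $ 4 = sqrt \<gamma> * (B $ 1 $ 2 + B $ 2 $ 1) / 2 \<and> x $ 5 = sqrt \<gamma> * B $ 1 $ 1"
  (is "?L \<longleftrightarrow> ?R")
proof -
  define y1 y2 y3 y4 y5 where y: "y1 = x $ 1 / sqrt \<alpha>" "y2 = x $ 2 / sqrt \<beta>"
    "y3 = x $ 3 / sqrt \<beta>" "y4 = x $ 4 / sqrt \<gamma>" "y5 = x $ 5 / sqrt \<gamma>"
  have tr: "B $ 2 $ 2 = - B $ 1 $ 1"
    using assms(4) by (simp add: G_lie_def trace_def sum_2)
  define j where "j = (B $ 1 $ 2 - B $ 2 $ 1) / 2"
  have m: "1 + \<mu>\<^sup>2 > 0" by (simp add: add_pos_nonneg)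
  have L: "?L \<longleftrightarrow> s = t * \<mu> + y1 \<and> B $ 1 $ 2 = t - \<mu> * y1 + y4 \<and> B $ 2 $ 1 = - t + \<mu> * y1 + y4
     \<and> B $ 1 $ 1 = y5 \<and> w $ 1 = y3 \<and> w $ 2 = y2"
    by (auto simp: frame_def y ebar0_def ebar1_def ebar2_def ebar3_def ebar4_def ebar5_def
        vec_eq_iff forall_2 Eplus_def Eminus_def X_mat_def tr field_simps zero_prod_def)
  have "?L \<longleftrightarrow> (s = t * \<mu> + y1 \<and> j = t - \<mu> * y1) \<and> y4 = (B $ 1 $ 2 + B $ 2 $ 1) / 2
     \<and> y5 = B $ 1 $ 1 \<and> y3 = w $ 1 \<and> y2 = w $ 2"
    unfolding L j_def by auto
  also have "(s = t * \<mu> + y1 \<and> j = t - \<mu> * y1) \<longleftrightarrow>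
      t = (j + \<mu> * s) / (1 + \<mu>\<^sup>2) \<and> y1 = (s - \<mu> * j) / (1 + \<mu>\<^sup>2)"
    (is "?a \<longleftrightarrow> ?b")
  proof
    assume ?a
    then have "j + \<mu> * s = t * (1 + \<mu>\<^sup>2)" "s - \<mu> * j = y1 * (1 + \<mu>\<^sup>2)"
      by (auto simp: algebra_simps power2_eq_square)
    then show ?b using m by simp
  next
    assume b: ?b
    have "t * \<mu> + y1 = (s * (1 + \<mu>\<^sup>2)) / (1 + \<mu>\<^sup>2)" "t - \<mu> * y1 = (j * (1 + \<mu>\<^sup>2)) / (1 + \<mu>\<^sup>2)"
      using b by (simp_all add: add_divide_distrib[symmetric] diff_divide_distrib[symmetric]
          algebra_simps power2_eq_square)
    then show ?a using m by simp
  qed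
  finally show ?thesis
    using assms by (auto simp: y j_def field_simps)
qed

lemma decomp_ex1:
  assumes "\<alpha> > 0" "\<beta> > 0" "\<gamma> > 0" "\<xi> \<in> G_lie"
  shows "\<exists>!p. \<xi> = fst p *\<^sub>R ebar0 \<mu> + frame \<mu> \<alpha> \<beta> \<gamma> (snd p)"
proof -
  obtain s B w where \<xi>: "\<xi> = (s, B, w)" by (cases \<xi>)
  define t where "t = ((B $ 1 $ 2 - B $ 2 $ 1) / 2 + \<mu> * s) / (1 + \<mu>\<^sup>2)"
  define x :: "real^5" where "x = (\<chi> i. if i = 1 then
        sqrt \<alpha> * (s - \<mu> * (B $ 1 $ 2 - B $ 2 $ 1) / 2) / (1 + \<mu>\<^sup>2)
      else if i = 2 then sqrt \<beta> * w $ 2 else if i = 3 then sqrt \<beta> * w $ 1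
      else if i = 4 then sqrt \<gamma> * (B $ 1 $ 2 + B $ 2 $ 1) / 2 else sqrt \<gamma> * B $ 1 $ 1)"
  note d = decomp_iff[OF assms(1-3) assms(4)[unfolded \<xi>]]
  show ?thesis
  proof (rule ex1I[of _ "(t, x)"])
    show "\<xi> = fst (t, x) *\<^sub>R ebar0 \<mu> + frame \<mu> \<alpha> \<beta> \<gamma> (snd (t, x))"
      unfolding \<xi> fst_conv snd_conv d by (simp add: t_def x_def)
  next
    fix p assume "\<xi> = fst p *\<^sub>R ebar0 \<mu> + frame \<mu> \<alpha> \<beta> \<gamma> (snd p)"
    then show "p = (t, x)"
      unfolding \<xi> d by (auto simp: t_def x_def prod_eq_iff vec_eq_iff forall_5)
  qed
qed

lemma coord_eq:
  assumes "\<alpha> > 0" "\<beta> > 0" "\<gamma> > 0" "t *\<^sub>R ebar0 \<mu> + frame \<mu> \<alpha> \<beta> \<gamma> x \<in> G_lie"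
  shows "h_coord \<mu> \<alpha> \<beta> \<gamma> (t *\<^sub>R ebar0 \<mu> + frame \<mu> \<alpha> \<beta> \<gamma> x) = t"
    "m_coord \<mu> \<alpha> \<beta> \<gamma> (t *\<^sub>R ebar0 \<mu> + frame \<mu> \<alpha> \<beta> \<gamma> x) = x"
proof -
  have *: "t' = t \<and> x' = x" if "t *\<^sub>R ebar0 \<mu> + frame \<mu> \<alpha> \<beta> \<gamma> x = t' *\<^sub>R ebar0 \<mu> + frame \<mu> \<alpha> \<beta> \<gamma> x'"
    for t' x'
    using decomp_ex1[OF assms, of \<mu>] that by (metis fst_conv snd_conv)
  show "h_coord \<mu> \<alpha> \<beta> \<gamma> (t *\<^sub>R ebar0 \<mu> + frame \<mu> \<alpha> \<beta> \<gamma> x) = t"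
    "m_coord \<mu> \<alpha> \<beta> \<gamma> (t *\<^sub>R ebar0 \<mu> + frame \<mu> \<alpha> \<beta> \<gamma> x) = x"
    unfolding h_coord_def m_coord_def using * by blast+
qed

lemma frame_in_G_lie: "frame \<mu> \<alpha> \<beta> \<gamma> x \<in> G_lie"
  by (simp add: frame_def G_lie_def ebar1_def ebar2_def ebar3_def ebar4_def ebar5_def
      trace_def sum_2 Eplus_def Eminus_def X_mat_def zero_prod_def)

lemma metric_frame:
  assumes "\<alpha> > 0" "\<beta> > 0" "\<gamma> > 0"
  shows "metric \<mu> \<alpha> \<beta> \<gamma> (frame \<mu> \<alpha> \<beta> \<gamma> x) (frame \<mu> \<alpha> \<beta> \<gamma> y) = x \<bullet> y"
proof -
  define c :: "real^5 \<Rightarrow> real^5" where "c x = (\<chi> i. x $ i / sqrt (if i = 1 then \<alpha> else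
     if i = 2 \<or> i = 3 then \<beta> else \<gamma>))" for x
  have "frame \<mu> \<alpha> \<beta> \<gamma> x = frame \<mu> 1 1 1 (c x)" for x
    by (simp add: frame_def c_def field_simps)
  moreover have "m_coord \<mu> 1 1 1 (frame \<mu> 1 1 1 z) = z" for z
    using coord_eq(2)[of 1 1 1 0 \<mu> z] by (simp add: frame_in_G_lie)
  ultimately show ?thesis
    using assms by (simp add: metric_def Let_def inner_vec_def sum_5 c_def)
qed

definition bracket_m :: "real \<Rightarrow> real \<Rightarrow> real \<Rightarrow> real \<Rightarrow> real^5 \<Rightarrow> real^5 \<Rightarrow> real^5" where
  "bracket_m \<mu> \<alpha> \<beta> \<gamma> x y =
     m_coord \<mu> \<alpha> \<beta> \<gamma> (lie_bracket (frame \<mu> \<alpha> \<beta> \<gamma> x) (frame \<mu> \<alpha> \<beta> \<gamma> y))"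

text \<open>The isotropy representation of \<open>H\<^sub>\<mu>\<close> on \<open>\<mm>\<close>, and the image of \<open>ebar0\<close> under its
  differential.\<close>
definition Ad_m :: "real \<Rightarrow> real \<Rightarrow> real \<Rightarrow> real \<Rightarrow> amb \<Rightarrow> real^5^5" where
  "Ad_m \<mu> \<alpha> \<beta> \<gamma> h = matrix (\<lambda>x. m_coord \<mu> \<alpha> \<beta> \<gamma> (Ad h (frame \<mu> \<alpha> \<beta> \<gamma> x)))"

definition isotropy :: "real \<Rightarrow> real \<Rightarrow> real \<Rightarrow> real \<Rightarrow> real^5^5" where
  "isotropy \<mu> \<alpha> \<beta> \<gamma> =
     matrix (\<lambda>x. m_coord \<mu> \<alpha> \<beta> \<gamma> (lie_bracket (ebar0 \<mu>) (frame \<mu> \<alpha> \<beta> \<gamma> x)))"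

lemma isotropy_eq:
  assumes "\<alpha> > 0" "\<beta> > 0" "\<gamma> > 0"
  shows "isotropy \<mu> \<alpha> \<beta> \<gamma> = Eij 2 3 + 2 *\<^sub>R Eij 4 5"
proof -
  have E: "((Eij 2 3 + 2 *\<^sub>R Eij 4 5) *v x) $ 1 = 0" "((Eij 2 3 + 2 *\<^sub>R Eij 4 5) *v x) $ 2 = - x $ 3"
    "((Eij 2 3 + 2 *\<^sub>R Eij 4 5) *v x) $ 3 = x $ 2" "((Eij 2 3 + 2 *\<^sub>R Eij 4 5) *v x) $ 4 = - 2 * x $ 5"
    "((Eij 2 3 + 2 *\<^sub>R Eij 4 5) *v x) $ 5 = 2 * x $ 4" for x
    by (simp_all add: matrix_vector_mult_def sum_5 Eij_def)
  have "lie_bracket (ebar0 \<mu>) (frame \<mu> \<alpha> \<beta> \<gamma> x) =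
      0 *\<^sub>R ebar0 \<mu> + frame \<mu> \<alpha> \<beta> \<gamma> ((Eij 2 3 + 2 *\<^sub>R Eij 4 5) *v x)" for x
    unfolding frame_def E
    by (simp add: ebar0_def ebar1_def ebar2_def ebar3_def ebar4_def ebar5_def
      vec_eq_iff forall_2 Eplus_def Eminus_def X_mat_def
      matrix_matrix_mult_def matrix_vector_mult_def sum_2)
  then have "m_coord \<mu> \<alpha> \<beta> \<gamma> (lie_bracket (ebar0 \<mu>) (frame \<mu> \<alpha> \<beta> \<gamma> x)) =
      (Eij 2 3 + 2 *\<^sub>R Eij 4 5) *v x" for x
    using coord_eq(2)[OF assms, of 0 \<mu>] by (simp add: frame_in_G_lie)
  then show ?thesis
    by (simp add: isotropy_def)
qed


section \<open>Invariant connections on \<open>G/H\<^sub>\<mu>\<close>\<close>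

text \<open>The tangent bundle of \<open>G/H\<^sub>\<mu>\<close> is \<open>G \<times>\<^bsub>H\<^esub> \<mm>\<close>, so vector fields are \<open>H\<^sub>\<mu>\<close>-equivariant
  functions \<open>V\<close> from \<open>G\<close> to \<open>\<mm>\<close>, and similarly for tensor fields, the invariant ones being the
  constant functions with \<open>H\<^sub>\<mu>\<close>-invariant values. An invariant connection is given by an
  \<open>H\<^sub>\<mu>\<close>-equivariant linear map \<open>\<Lambda>\<close> from \<open>\<mm>\<close> to the endomorphisms of \<open>\<mm>\<close>, extended to the Lie
  algebra of \<open>G\<close> by the isotropy representation (\<open>conn_ext\<close>): its covariant derivative along the
  left-invariant vector field \<open>\<xi>\<close> is \<open>\<xi>(V) + \<Lambda>(\<xi>) V\<close>. Differentiating constant functions gives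
  zero, which yields the expressions below for the torsion, the curvature and the covariant
  derivative of an invariant tensor.

  The value at the base point of the difference of an arbitrary linear connection and the invariant
  connection \<open>\<Lambda> = 0\<close> is also a linear map \<open>\<Lambda>\<close>; its metricity, its torsion and preservation of an
  invariant structure are given at the base point by the same expressions. Therefore \<open>levi_civita\<close>
  and \<open>characteristic\<close> do not demand equivariance.\<close>

type_synonym conn = "real^5 \<Rightarrow> real^5^5"

definition invariant_connection :: "real \<Rightarrow> real \<Rightarrow> real \<Rightarrow> real \<Rightarrow> conn \<Rightarrow> bool" where
  "invariant_connection \<mu> \<alpha> \<beta> \<gamma> \<Lambda> \<longleftrightarrow> linear \<Lambda> \<and>
     (\<forall>h\<in>H_mu \<mu>. \<forall>x. \<Lambda> (Ad_m \<mu> \<alpha> \<beta> \<gamma> h *v x) =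
        Ad_m \<mu> \<alpha> \<beta> \<gamma> h ** \<Lambda> x ** matrix_inv (Ad_m \<mu> \<alpha> \<beta> \<gamma> h))"

definition conn_ext :: "real \<Rightarrow> real \<Rightarrow> real \<Rightarrow> real \<Rightarrow> conn \<Rightarrow> amb \<Rightarrow> real^5^5" where
  "conn_ext \<mu> \<alpha> \<beta> \<gamma> \<Lambda> \<xi> =
     h_coord \<mu> \<alpha> \<beta> \<gamma> \<xi> *\<^sub>R isotropy \<mu> \<alpha> \<beta> \<gamma> + \<Lambda> (m_coord \<mu> \<alpha> \<beta> \<gamma> \<xi>)"

definition metric_conn :: "conn \<Rightarrow> bool" where
  "metric_conn \<Lambda> \<longleftrightarrow> (\<forall>x y z. (\<Lambda> x *v y) \<bullet> z + y \<bullet> (\<Lambda> x *v z) = 0)"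

definition torsion :: "real \<Rightarrow> real \<Rightarrow> real \<Rightarrow> real \<Rightarrow> conn \<Rightarrow> real^5 \<Rightarrow> real^5 \<Rightarrow> real^5" where
  "torsion \<mu> \<alpha> \<beta> \<gamma> \<Lambda> x y = \<Lambda> x *v y - \<Lambda> y *v x - bracket_m \<mu> \<alpha> \<beta> \<gamma> x y"

definition torsion_form :: "real \<Rightarrow> real \<Rightarrow> real \<Rightarrow> real \<Rightarrow> conn \<Rightarrow> tensor3" where
  "torsion_form \<mu> \<alpha> \<beta> \<gamma> \<Lambda> x y z = torsion \<mu> \<alpha> \<beta> \<gamma> \<Lambda> x y \<bullet> z"

definition curvature ::
  "real \<Rightarrow> real \<Rightarrow> real \<Rightarrow> real \<Rightarrow> conn \<Rightarrow> real^5 \<Rightarrow> real^5 \<Rightarrow> real^5^5" where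
  "curvature \<mu> \<alpha> \<beta> \<gamma> \<Lambda> x y =
     \<Lambda> x ** \<Lambda> y - \<Lambda> y ** \<Lambda> x
     - conn_ext \<mu> \<alpha> \<beta> \<gamma> \<Lambda> (lie_bracket (frame \<mu> \<alpha> \<beta> \<gamma> x) (frame \<mu> \<alpha> \<beta> \<gamma> y))"

definition cov_deriv :: "conn \<Rightarrow> tensor3 \<Rightarrow> real^5 \<Rightarrow> tensor3" where
  "cov_deriv \<Lambda> S v x y z = - S (\<Lambda> v *v x) y z - S x (\<Lambda> v *v y) z - S x y (\<Lambda> v *v z)"

definition levi_civita :: "real \<Rightarrow> real \<Rightarrow> real \<Rightarrow> real \<Rightarrow> conn" where
  "levi_civita \<mu> \<alpha> \<beta> \<gamma> =
     (THE \<Lambda>. linear \<Lambda> \<and> metric_conn \<Lambda> \<and> (\<forall>x y. torsion \<mu> \<alpha> \<beta> \<gamma> \<Lambda> x y = 0))"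

definition nearly_integrable :: "real \<Rightarrow> real \<Rightarrow> real \<Rightarrow> real \<Rightarrow> bool" where
  "nearly_integrable \<mu> \<alpha> \<beta> \<gamma> \<longleftrightarrow>
     (\<forall>v. cov_deriv (levi_civita \<mu> \<alpha> \<beta> \<gamma>) Upsilon v v v v = 0)"

definition characteristic :: "real \<Rightarrow> real \<Rightarrow> real \<Rightarrow> real \<Rightarrow> conn \<Rightarrow> bool" where
  "characteristic \<mu> \<alpha> \<beta> \<gamma> \<Lambda> \<longleftrightarrow> linear \<Lambda> \<and> metric_conn \<Lambda> \<and> (\<forall>x. \<Lambda> x \<in> so3_ir) \<and>
     (\<forall>x y z. torsion_form \<mu> \<alpha> \<beta> \<gamma> \<Lambda> x y z = - torsion_form \<mu> \<alpha> \<beta> \<gamma> \<Lambda> y x z \<and>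
              torsion_form \<mu> \<alpha> \<beta> \<gamma> \<Lambda> x y z = - torsion_form \<mu> \<alpha> \<beta> \<gamma> \<Lambda> x z y)"

definition divergence :: "real \<Rightarrow> real \<Rightarrow> real \<Rightarrow> real \<Rightarrow> tensor3 \<Rightarrow> real^5 \<Rightarrow> real^5 \<Rightarrow> real" where
  "divergence \<mu> \<alpha> \<beta> \<gamma> T x y =
     - (\<Sum>i\<in>UNIV. cov_deriv (levi_civita \<mu> \<alpha> \<beta> \<gamma>) T (axis i 1) (axis i 1) x y)"

definition wedge3 :: "real^5 \<Rightarrow> real^5 \<Rightarrow> real^5 \<Rightarrow> tensor3" where
  "wedge3 a b c x y z = det (vector [vector [a \<bullet> x, a \<bullet> y, a \<bullet> z],
                                     vector [b \<bullet> x, b \<bullet> y, b \<bullet> z],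
                                     vector [c \<bullet> x, c \<bullet> y, c \<bullet> z]] :: real^3^3)"

text \<open>The holonomy group at the base point, in the frame \<open>e\<^sub>1, \<dots>, e\<^sub>5\<close>. A loop at the base point is
  the projection of a curve \<open>g\<close> in \<open>G\<close> from the unit to some \<open>g 1\<close> in \<open>H\<^sub>\<mu>\<close>. With \<open>\<xi> = g\<^sup>-\<^sup>1 g'\<close>,
  a vector field \<open>[g t, v t]\<close> along the loop is parallel iff \<open>v' = - \<Lambda>(\<xi>) v\<close>, hence
  \<open>v t = P t v\<^sub>0\<close> for the solution \<open>P\<close> below, and the transported vector \<open>[g 1, P 1 v\<^sub>0]\<close> equals
  \<open>[1, Ad (g 1) (P 1 v\<^sub>0)]\<close>.\<close>
definition holonomy :: "real \<Rightarrow> real \<Rightarrow> real \<Rightarrow> real \<Rightarrow> conn \<Rightarrow> (real^5^5) set" where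
  "holonomy \<mu> \<alpha> \<beta> \<gamma> \<Lambda> = {Ad_m \<mu> \<alpha> \<beta> \<gamma> (g 1) ** P 1 | g P.
     g piecewise_C1_differentiable_on {0..1} \<and> g ` {0..1} \<subseteq> G_carrier \<and>
     g 0 = G_one \<and> g 1 \<in> H_mu \<mu> \<and>
     continuous_on {0..1} P \<and> P 0 = mat 1 \<and>
     (\<exists>S \<xi>. finite S \<and> (\<forall>t\<in>{0..1} - S. \<xi> t \<in> G_lie \<and>
        (g has_vector_derivative left_trans (g t) (\<xi> t)) (at t within {0..1}) \<and>
        (P has_vector_derivative - (conn_ext \<mu> \<alpha> \<beta> \<gamma> \<Lambda> (\<xi> t) ** P t)) (at t within {0..1})))}"

definition naturally_reductive :: "real \<Rightarrow> real \<Rightarrow> real \<Rightarrow> real \<Rightarrow> bool" where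
  "naturally_reductive \<mu> \<alpha> \<beta> \<gamma> \<longleftrightarrow>
     (\<forall>x y z. bracket_m \<mu> \<alpha> \<beta> \<gamma> x y \<bullet> z = - (bracket_m \<mu> \<alpha> \<beta> \<gamma> y x \<bullet> z) \<and>
              bracket_m \<mu> \<alpha> \<beta> \<gamma> x y \<bullet> z = - (bracket_m \<mu> \<alpha> \<beta> \<gamma> x z \<bullet> y))"

text \<open>\<open>Ric(x, y)\<close> is the trace of \<open>z \<mapsto> R(z, x) y\<close>.\<close>
definition ricci :: "real \<Rightarrow> real \<Rightarrow> real \<Rightarrow> real \<Rightarrow> real^5 \<Rightarrow> real^5 \<Rightarrow> real" where
  "ricci \<mu> \<alpha> \<beta> \<gamma> x y =
     trace (matrix (\<lambda>z. curvature \<mu> \<alpha> \<beta> \<gamma> (levi_civita \<mu> \<alpha> \<beta> \<gamma>) z x *v y))"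

definition einstein :: "real \<Rightarrow> real \<Rightarrow> real \<Rightarrow> real \<Rightarrow> bool" where
  "einstein \<mu> \<alpha> \<beta> \<gamma> \<longleftrightarrow> (\<exists>c. \<forall>x y. ricci \<mu> \<alpha> \<beta> \<gamma> x y = c * (x \<bullet> y))"

end

theory Submission
  imports Defs
begin

text \<open>
  An orthogonal transformation preserving \<open>\<Upsilon>\<close> moves \<open>e\<^sub>1\<close> to a solution \<open>v\<close> of
  \<open>\<Upsilon>(v, v, \<cdot>) = g(v, \<cdot>)\<close>; these form a Veronese surface, and rotating \<open>v\<close> back to \<open>e\<^sub>1\<close> leaves only
  the stabilizer of \<open>e\<^sub>1\<close>. So the stabilizer of \<open>\<Upsilon>\<close> is \<open>SO(3)\<^sub>i\<^sub>r\<close>, and it is generated by the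
  rotations \<open>exp (t Y\<^sub>1)\<close> and \<open>exp (t Y\<^sub>2)\<close>.

  In the orthonormal frame the structure constants are \<open>p = \<mu> / \<surd>\<alpha>\<close>, \<open>q = 1 / \<surd>\<gamma>\<close> and
  \<open>r = \<mu> \<surd>\<alpha> / (\<gamma> (1 + \<mu>\<^sup>2))\<close>, and near integrability amounts to \<open>r = \<surd>3 q\<close>, a quadratic equation
  for \<open>\<mu>\<close>. The Ricci curvature is \<open>2 r\<^sup>2\<close> along \<open>e\<^sub>1\<close> and \<open>0\<close> along \<open>e\<^sub>2\<close>, which excludes Einstein metrics.

  The holonomy lies in \<open>SO(3)\<^sub>i\<^sub>r\<close> because parallel transport preserves \<open>\<Upsilon>\<close>. Conversely, along paths in
  the abelian subgroup \<open>\<real>\<^sup>2\<close> of \<open>G\<close> the characteristic connection is that of a ball rolling on a plane,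
  and the boundary of a rectangle one of whose sides makes the ball turn by \<open>\<pi>\<close> already gives every
  \<open>exp (t Y\<^sub>1)\<close> and every \<open>exp (t Y\<^sub>2)\<close>.
\<close>

section \<open>Rotations and one-parameter subgroups\<close>

definition vec5 :: "real \<Rightarrow> real \<Rightarrow> real \<Rightarrow> real \<Rightarrow> real \<Rightarrow> real^5" where
  "vec5 a b c d e = (\<chi> i. if i = 1 then a else if i = 2 then b else if i = 3 then c
     else if i = 4 then d else e)"

lemma vec5_nth [simp]:
  "vec5 a b c d e $ 1 = a" "vec5 a b c d e $ 2 = b" "vec5 a b c d e $ 3 = c"
  "vec5 a b c d e $ 4 = d" "vec5 a b c d e $ 5 = e"
  by (simp_all add: vec5_def)

lemma vec5_eq_iff: "x = y \<longleftrightarrow> x $ 1 = y $ 1 \<and> x $ 2 = y $ 2 \<and> x $ 3 = y $ 3 \<and> x $ 4 = y $ 4 \<and> x $ 5 = y $ 5"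
  for x y :: "real^5"
  by (simp add: vec_eq_iff forall_5)

lemma inner_5: "x \<bullet> y = x $ 1 * y $ 1 + x $ 2 * y $ 2 + x $ 3 * y $ 3 + x $ 4 * y $ 4 + x $ 5 * y $ 5"
  for x y :: "real^5"
  by (simp add: inner_vec_def sum_5)

lemma axis_5_nth [simp]:
  "axis i (a::real) $ i = a" "i \<noteq> j \<Longrightarrow> axis i (a::real) $ j = 0"
  by (simp_all add: axis_def)

lemma sqrt3_mult [simp]: "sqrt 3 * (sqrt 3 * x) = 3 * x"
  by (simp flip: mult.assoc)

lemma Y1_mult: "Y1 *v x = vec5 (sqrt 3 * x $ 2) (- sqrt 3 * x $ 1 - x $ 4) (- x $ 5) (x $ 2) (x $ 3)"
  by (simp add: vec5_eq_iff Y1_def matrix_vector_mult_def sum_5 Eij_def)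

lemma Y2_mult: "Y2 *v x = vec5 (sqrt 3 * x $ 3) (- x $ 5) (- sqrt 3 * x $ 1 + x $ 4) (- x $ 3) (x $ 2)"
  by (simp add: vec5_eq_iff Y2_def matrix_vector_mult_def sum_5 Eij_def)

lemma Y3_mult: "Y3 *v x = vec5 0 (- x $ 3) (x $ 2) (- 2 * x $ 5) (2 * x $ 4)"
  by (simp add: vec5_eq_iff Y3_def matrix_vector_mult_def sum_5 Eij_def)

lemma so3_ir_iff: "Y \<in> so3_ir \<longleftrightarrow> (\<exists>a b c. Y = a *\<^sub>R Y1 + b *\<^sub>R Y2 + c *\<^sub>R Y3)"
  by (auto simp: so3_ir_def span_breakdown_eq algebra_simps)

text \<open>The explicit form of exp (t \<open>Y1\<close>). The kernel of \<open>Y1\<close> is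
  spanned by (e_1 - sqrt 3 e_4) / 2, with coordinate \<open>n\<close>. \<open>Y1\<close> turns the
  plane of (sqrt 3 e_1 + e_4) / 2 (coordinate \<open>f\<close>) and e_2 at speed 2, and the plane of
  e_3 and e_5 at speed 1. \<open>R2\<close> has the same shape with e_2, e_3 exchanged and e_4
  reversed.\<close>

definition R1 :: "real \<Rightarrow> real^5^5" where
  "R1 t = matrix (\<lambda>v. let n = (v $ 1 - sqrt 3 * v $ 4) / 2; f = (sqrt 3 * v $ 1 + v $ 4) / 2;
       f' = cos (2 * t) * f + sin (2 * t) * v $ 2
     in vec5 (n / 2 + sqrt 3 / 2 * f') (cos (2 * t) * v $ 2 - sin (2 * t) * f)
       (cos t * v $ 3 - sin t * v $ 5) (- sqrt 3 / 2 * n + f' / 2) (sin t * v $ 3 + cos t * v $ 5))"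

definition R2 :: "real \<Rightarrow> real^5^5" where
  "R2 t = matrix (\<lambda>v. let n = (v $ 1 + sqrt 3 * v $ 4) / 2; f = (sqrt 3 * v $ 1 - v $ 4) / 2;
       f' = cos (2 * t) * f + sin (2 * t) * v $ 3
     in vec5 (n / 2 + sqrt 3 / 2 * f') (cos t * v $ 2 - sin t * v $ 5)
       (cos (2 * t) * v $ 3 - sin (2 * t) * f) (sqrt 3 / 2 * n - f' / 2) (sin t * v $ 2 + cos t * v $ 5))"

definition R3 :: "real \<Rightarrow> real^5^5" where
  "R3 t = matrix (\<lambda>v. vec5 (v $ 1) (cos t * v $ 2 - sin t * v $ 3) (sin t * v $ 2 + cos t * v $ 3)
     (cos (2 * t) * v $ 4 - sin (2 * t) * v $ 5) (sin (2 * t) * v $ 4 + cos (2 * t) * v $ 5))"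

lemma matrix_mult_vec: "linear f \<Longrightarrow> matrix f *v x = f x"
  for f :: "real^'n \<Rightarrow> real^'m"
  by (simp add: matrix_works linear_matrix_vector_mul_eq)

lemma R1_mult: "R1 t *v v = (let n = (v $ 1 - sqrt 3 * v $ 4) / 2; f = (sqrt 3 * v $ 1 + v $ 4) / 2;
       f' = cos (2 * t) * f + sin (2 * t) * v $ 2
     in vec5 (n / 2 + sqrt 3 / 2 * f') (cos (2 * t) * v $ 2 - sin (2 * t) * f)
       (cos t * v $ 3 - sin t * v $ 5) (- sqrt 3 / 2 * n + f' / 2) (sin t * v $ 3 + cos t * v $ 5))"
  unfolding R1_def
  by (rule matrix_mult_vec[OF linearI]; simp add: vec5_eq_iff Let_def field_simps)

lemma R2_mult: "R2 t *v v = (let n = (v $ 1 + sqrt 3 * v $ 4) / 2; f = (sqrt 3 * v $ 1 - v $ 4) / 2;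
       f' = cos (2 * t) * f + sin (2 * t) * v $ 3
     in vec5 (n / 2 + sqrt 3 / 2 * f') (cos t * v $ 2 - sin t * v $ 5)
       (cos (2 * t) * v $ 3 - sin (2 * t) * f) (sqrt 3 / 2 * n - f' / 2) (sin t * v $ 2 + cos t * v $ 5))"
  unfolding R2_def
  by (rule matrix_mult_vec[OF linearI]; simp add: vec5_eq_iff Let_def field_simps)

lemma R3_mult: "R3 t *v v = vec5 (v $ 1) (cos t * v $ 2 - sin t * v $ 3) (sin t * v $ 2 + cos t * v $ 3)
     (cos (2 * t) * v $ 4 - sin (2 * t) * v $ 5) (sin (2 * t) * v $ 4 + cos (2 * t) * v $ 5)"
  unfolding R3_def
  by (rule matrix_mult_vec[OF linearI]; simp add: vec5_eq_iff Let_def field_simps)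

lemma matrix_eqI: "(\<And>x. A *v x = B *v x) \<Longrightarrow> A = B" for A B :: "real^'n^'m"
  by (simp add: matrix_eq)

lemma R1_0 [simp]: "R1 0 = mat 1"
  by (rule matrix_eqI) (simp add: R1_mult Let_def vec5_eq_iff field_simps)
lemma R2_0 [simp]: "R2 0 = mat 1"
  by (rule matrix_eqI) (simp add: R2_mult Let_def vec5_eq_iff field_simps)
lemma R3_0 [simp]: "R3 0 = mat 1"
  by (rule matrix_eqI) (simp add: R3_mult Let_def vec5_eq_iff field_simps)

lemma R1_add: "R1 (s + t) = R1 s ** R1 t"
  by (rule matrix_eqI) (simp add: R1_mult Let_def vec5_eq_iff distrib_left cos_add sin_add
      field_simps flip: matrix_vector_mul_assoc)
lemma R2_add: "R2 (s + t) = R2 s ** R2 t"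
  by (rule matrix_eqI) (simp add: R2_mult Let_def vec5_eq_iff distrib_left cos_add sin_add
      field_simps flip: matrix_vector_mul_assoc)
lemma R3_add: "R3 (s + t) = R3 s ** R3 t"
  by (rule matrix_eqI) (simp add: R3_mult Let_def vec5_eq_iff distrib_left cos_add sin_add
      field_simps flip: matrix_vector_mul_assoc)

lemma has_vector_derivative_vec_iff:
  "(f has_vector_derivative d) (at t within S) \<longleftrightarrow>
    (\<forall>i. ((\<lambda>t. f t $ i) has_vector_derivative d $ i) (at t within S))"
  for f :: "real \<Rightarrow> 'a::euclidean_space^'n"
  unfolding has_vector_derivative_def
  by (subst has_derivative_componentwise_within, subst has_derivative_componentwise_within)
    (auto simp: Basis_vec_def inner_axis)

lemma has_vector_derivative_matrixI:
  assumes "\<And>x. ((\<lambda>t. F t *v x) has_vector_derivative D *v x) (at t within S)"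
  shows "(F has_vector_derivative (D :: real^'n^'m)) (at t within S)"
proof -
  have "((\<lambda>t. F t $ i $ j) has_vector_derivative D $ i $ j) (at t within S)" for i j
    using assms[of "axis j 1"] by (simp add: has_vector_derivative_vec_iff matrix_vector_mult_basis column_def)
  then show ?thesis
    by (simp add: has_vector_derivative_vec_iff[where f = F]
        has_vector_derivative_vec_iff[where f = "\<lambda>t. F t $ i" for i])
qed

lemma bounded_linear_mult_vec: "bounded_linear (\<lambda>A::real^'n^'m. A *v x)"
  unfolding linear_conv_bounded_linear[symmetric]
  by (rule linearI; simp add: matrix_vector_mult_add_rdistrib flip: scaleR_matrix_vector_assoc)

lemmas has_vector_derivative_mult_vec = bounded_linear.has_vector_derivative[OF bounded_linear_mult_vec]

lemma R1_deriv: "(R1 has_vector_derivative Y1) (at 0)"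
  by (rule has_vector_derivative_matrixI)
    (auto simp: has_vector_derivative_vec_iff R1_mult Y1_mult forall_5 Let_def field_simps
      simp flip: has_real_derivative_iff_has_vector_derivative intro!: derivative_eq_intros)
lemma R2_deriv: "(R2 has_vector_derivative Y2) (at 0)"
  by (rule has_vector_derivative_matrixI)
    (auto simp: has_vector_derivative_vec_iff R2_mult Y2_mult forall_5 Let_def field_simps
      simp flip: has_real_derivative_iff_has_vector_derivative intro!: derivative_eq_intros)
lemma R3_deriv: "(R3 has_vector_derivative Y3) (at 0)"
  by (rule has_vector_derivative_matrixI)
    (auto simp: has_vector_derivative_vec_iff R3_mult Y3_mult forall_5 Let_def field_simps
      simp flip: has_real_derivative_iff_has_vector_derivative intro!: derivative_eq_intros)

lemma one_parameter_subgroup_R: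
  "one_parameter_subgroup (**) (mat 1) Y1 R1" "one_parameter_subgroup (**) (mat 1) Y2 R2"
  "one_parameter_subgroup (**) (mat 1) Y3 R3"
  by (simp_all add: one_parameter_subgroup_def R1_add R2_add R3_add R1_deriv R2_deriv R3_deriv)

lemma bounded_linear_matrix_mult:
  fixes A :: "real^'n^'m" and B :: "real^'k^'n"
  shows "bounded_linear (\<lambda>A::real^'n^'m. A ** B)" "bounded_linear (\<lambda>B::real^'k^'n. A ** B)"
  unfolding linear_conv_bounded_linear[symmetric]
  by (rule linearI; simp add: matrix_matrix_mult_def vec_eq_iff algebra_simps sum.distrib sum_distrib_left)+

text \<open>A one-parameter subgroup is only assumed differentiable at 0. Writing c s as c (s - t)
  ** c t, or with the factors exchanged, carries the derivative to every t.\<close>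

lemma one_parameter_subgroup_matrix_deriv:
  fixes c :: "real \<Rightarrow> real^'n^'n"
  assumes "one_parameter_subgroup (**) (mat 1) Y c"
  shows "(c has_vector_derivative Y ** c t) (at t)" "(c has_vector_derivative c t ** Y) (at t)"
proof -
  have add: "c (s + t) = c s ** c t" for s t
    using assms by (simp add: one_parameter_subgroup_def)
  have d: "(c has_vector_derivative Y) (at 0)"
    using assms by (simp add: one_parameter_subgroup_def)
  have sh: "((\<lambda>s. c (s - t)) has_vector_derivative Y) (at t)"
  proof -
    have "((\<lambda>s. s - t) has_vector_derivative 1) (at t)"
      by (auto intro!: derivative_eq_intros simp flip: has_real_derivative_iff_has_vector_derivative)
    then show ?thesis
      using vector_diff_chain_at[of "\<lambda>s. s - t" 1 t c Y] d by (simp add: o_def)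
  qed
  have "((\<lambda>s. c (s - t) ** c t) has_vector_derivative Y ** c t) (at t)"
    by (rule bounded_linear.has_vector_derivative[OF bounded_linear_matrix_mult(1) sh])
  then show "(c has_vector_derivative Y ** c t) (at t)"
    by (simp flip: add)
  have "((\<lambda>s. c t ** c (s - t)) has_vector_derivative c t ** Y) (at t)"
    by (rule bounded_linear.has_vector_derivative[OF bounded_linear_matrix_mult(2) sh])
  then show "(c has_vector_derivative c t ** Y) (at t)"
    by (simp flip: add)
qed

section \<open>The stabilizer of the tensor\<close>

text \<open>Identify the 5-dimensional space with the traceless symmetric 3x3 matrices: this is then
  the polarization of a multiple of the determinant.\<close>

definition Upsilon0 :: tensor3 where
  "Upsilon0 x y z = x $ 1 * y $ 1 * z $ 1
    + (x $ 1 * (y $ 2 * z $ 2 + y $ 3 * z $ 3) + y $ 1 * (x $ 2 * z $ 2 + x $ 3 * z $ 3)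
       + z $ 1 * (x $ 2 * y $ 2 + x $ 3 * y $ 3)) / 2
    - (x $ 1 * (y $ 4 * z $ 4 + y $ 5 * z $ 5) + y $ 1 * (x $ 4 * z $ 4 + x $ 5 * z $ 5)
       + z $ 1 * (x $ 4 * y $ 4 + x $ 5 * y $ 5))
    - sqrt 3 / 2 * (x $ 4 * (y $ 2 * z $ 2 - y $ 3 * z $ 3) + y $ 4 * (x $ 2 * z $ 2 - x $ 3 * z $ 3)
       + z $ 4 * (x $ 2 * y $ 2 - x $ 3 * y $ 3)
       + x $ 5 * (y $ 2 * z $ 3 + y $ 3 * z $ 2) + y $ 5 * (x $ 2 * z $ 3 + x $ 3 * z $ 2)
       + z $ 5 * (x $ 2 * y $ 3 + x $ 3 * y $ 2))"

lemma Upsilon0_sym: "Upsilon0 x y z = Upsilon0 y x z" "Upsilon0 x y z = Upsilon0 x z y"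
  by (simp_all add: Upsilon0_def algebra_simps)

lemma Upsilon0_linear: "linear (\<lambda>x. Upsilon0 x y z)" "linear (\<lambda>y. Upsilon0 x y z)" "linear (\<lambda>z. Upsilon0 x y z)"
  by (rule linearI; simp add: Upsilon0_def field_simps)+

lemma Upsilon0_Y:
  assumes "Y \<in> so3_ir"
  shows "Upsilon0 (Y *v x) y z + Upsilon0 x (Y *v y) z + Upsilon0 x y (Y *v z) = 0"
proof -
  obtain a b c where Y: "Y = a *\<^sub>R Y1 + b *\<^sub>R Y2 + c *\<^sub>R Y3"
    using assms so3_ir_iff by auto
  have e: "Upsilon0 (Y1 *v x) y z + Upsilon0 x (Y1 *v y) z + Upsilon0 x y (Y1 *v z) = 0"
    "Upsilon0 (Y2 *v x) y z + Upsilon0 x (Y2 *v y) z + Upsilon0 x y (Y2 *v z) = 0"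
    "Upsilon0 (Y3 *v x) y z + Upsilon0 x (Y3 *v y) z + Upsilon0 x y (Y3 *v z) = 0"
    by (simp_all add: Upsilon0_def Y1_mult Y2_mult Y3_mult field_simps)
  have "Upsilon0 (Y *v x) y z + Upsilon0 x (Y *v y) z + Upsilon0 x y (Y *v z) =
    a * (Upsilon0 (Y1 *v x) y z + Upsilon0 x (Y1 *v y) z + Upsilon0 x y (Y1 *v z))
    + b * (Upsilon0 (Y2 *v x) y z + Upsilon0 x (Y2 *v y) z + Upsilon0 x y (Y2 *v z))
    + c * (Upsilon0 (Y3 *v x) y z + Upsilon0 x (Y3 *v y) z + Upsilon0 x y (Y3 *v z))"
    unfolding Y by (simp add: linear_add[OF Upsilon0_linear(1)]
       linear_add[OF Upsilon0_linear(2)] linear_add[OF Upsilon0_linear(3)]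
       linear_scale[OF Upsilon0_linear(1)] linear_scale[OF Upsilon0_linear(2)] linear_scale[OF Upsilon0_linear(3)]
       algebra_simps flip: scaleR_matrix_vector_assoc)
  then show ?thesis using e by simp
qed

lemma skew_Y:
  assumes "Y \<in> so3_ir"
  shows "(Y *v x) \<bullet> y + x \<bullet> (Y *v y) = 0"
  using assms by (auto simp: so3_ir_iff inner_5 Y1_mult Y2_mult Y3_mult
    algebra_simps simp flip: scaleR_matrix_vector_assoc)

text \<open>The stabilizer is taken in O(5); that it is connected comes out of
  \<open>stab_subset_R12\<close>.\<close>

definition stab :: "(real^5^5) set" where
  "stab = {A. (\<forall>x y. (A *v x) \<bullet> (A *v y) = x \<bullet> y) \<and>
     (\<forall>x y z. Upsilon0 (A *v x) (A *v y) (A *v z) = Upsilon0 x y z)}"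

lemma stab_mult: "A \<in> stab \<Longrightarrow> B \<in> stab \<Longrightarrow> A ** B \<in> stab"
  by (simp add: stab_def flip: matrix_vector_mul_assoc)

lemma stab_1 [simp]: "mat 1 \<in> stab"
  by (simp add: stab_def)

text \<open>\<open>contract\<close> turns the last slot into an inner product, so the rule follows
  from two bounded bilinear products.\<close>

lemma trilinear_has_derivative:
  fixes U :: tensor3
  assumes lin: "\<And>y z. linear (\<lambda>x. U x y z)" "\<And>x z. linear (\<lambda>y. U x y z)" "\<And>x y. linear (\<lambda>z. U x y z)"
    and "(X has_vector_derivative X') (at t within S)" "(Y has_vector_derivative Y') (at t within S)"
    "(Z has_vector_derivative Z') (at t within S)"
  shows "((\<lambda>t. U (X t) (Y t) (Z t)) has_real_derivative
     U X' (Y t) (Z t) + U (X t) Y' (Z t) + U (X t) (Y t) Z') (at t within S)"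
proof -
  have U: "U x y z = contract U x y \<bullet> z" for x y z
    using lin(3) by (simp add: contract_inner)
  have "bilinear (contract U)"
    unfolding bilinear_def
    by (intro conjI allI linearI;
        simp add: contract_def vec_eq_iff linear_add[OF lin(1)] linear_add[OF lin(2)]
          linear_scale[OF lin(1)] linear_scale[OF lin(2)])
  then have m: "bounded_bilinear (contract U)"
    by (simp add: bilinear_conv_bounded_bilinear)
  have "((\<lambda>t. contract U (X t) (Y t) \<bullet> Z t) has_vector_derivative
     contract U (X t) (Y t) \<bullet> Z' + (contract U (X t) Y' + contract U X' (Y t)) \<bullet> Z t) (at t within S)"
    by (intro bounded_bilinear.has_vector_derivative[OF bounded_bilinear_inner]
        bounded_bilinear.has_vector_derivative[OF m] assms)
  then show ?thesis
    by (simp add: U inner_add_left has_real_derivative_iff_has_vector_derivative add_ac)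
qed

lemmas Upsilon0_has_derivative = trilinear_has_derivative[of Upsilon0, OF Upsilon0_linear]

text \<open>No existence theory for the differential equation is needed: its solutions stay in \<open>stab\<close>
  because the tensors defining \<open>stab\<close> are constant along them.\<close>
lemma stab_ode:
  assumes "finite S" and cont: "continuous_on {a..b} P" and "P a \<in> stab"
    and d: "\<And>t. t \<in> {a..b} - S \<Longrightarrow> K t \<in> so3_ir \<and>
      (P has_vector_derivative K t ** P t) (at t within {a..b})"
    and t: "t \<in> {a..b}"
  shows "P t \<in> stab"
proof -
  have Pv: "continuous_on {a..b} (\<lambda>t. P t *v x)" for x
    by (rule bounded_linear.continuous_on[OF bounded_linear_mult_vec cont])
  have dP: "((\<lambda>t. P t *v x) has_vector_derivative K t *v (P t *v x)) (at t within {a..b})"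
    if "t \<in> {a..b} - S" for t x
    using has_vector_derivative_mult_vec[OF conjunct2[OF d[OF that]], of x]
    by (simp add: matrix_vector_mul_assoc)
  have "(P t *v x) \<bullet> (P t *v y) = x \<bullet> y" for x y
  proof (rule has_derivative_zero_unique_strong_interval[OF assms(1) _ _ _ t])
    show "continuous_on {a..b} (\<lambda>t. (P t *v x) \<bullet> (P t *v y))"
      by (intro continuous_intros Pv)
    show "(P a *v x) \<bullet> (P a *v y) = x \<bullet> y"
      using assms(3) by (simp add: stab_def)
    fix s assume s: "s \<in> {a..b} - S"
    have "((\<lambda>t. (P t *v x) \<bullet> (P t *v y)) has_vector_derivative
      (P s *v x) \<bullet> (K s *v (P s *v y)) + (K s *v (P s *v x)) \<bullet> (P s *v y)) (at s within {a..b})"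
      by (rule bounded_bilinear.has_vector_derivative[OF bounded_bilinear_inner dP[OF s] dP[OF s]])
    then show "((\<lambda>t. (P t *v x) \<bullet> (P t *v y)) has_derivative (\<lambda>h. 0)) (at s within {a..b})"
      using skew_Y[of "K s" "P s *v x" "P s *v y"] d[OF s]
      by (simp add: has_vector_derivative_def add.commute)
  qed
  moreover have "Upsilon0 (P t *v x) (P t *v y) (P t *v z) = Upsilon0 x y z" for x y z
  proof (rule has_derivative_zero_unique_strong_interval[OF assms(1) _ _ _ t])
    show "continuous_on {a..b} (\<lambda>t. Upsilon0 (P t *v x) (P t *v y) (P t *v z))"
      unfolding Upsilon0_def by (intro continuous_intros Pv) simp
    show "Upsilon0 (P a *v x) (P a *v y) (P a *v z) = Upsilon0 x y z"
      using assms(3) by (simp add: stab_def)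
    fix s assume s: "s \<in> {a..b} - S"
    have "((\<lambda>t. Upsilon0 (P t *v x) (P t *v y) (P t *v z)) has_real_derivative
      0) (at s within {a..b})"
      using Upsilon0_has_derivative[OF dP[OF s] dP[OF s] dP[OF s], of x y z] Upsilon0_Y d[OF s] by simp
    then show "((\<lambda>t. Upsilon0 (P t *v x) (P t *v y) (P t *v z)) has_derivative (\<lambda>h. 0)) (at s within {a..b})"
      by (simp add: has_real_derivative_iff_has_vector_derivative has_vector_derivative_def)
  qed
  ultimately show ?thesis by (simp add: stab_def)
qed

lemma one_parameter_subgroup_stab:
  assumes c: "one_parameter_subgroup (**) (mat 1) Y c" and Y: "Y \<in> so3_ir"
  shows "c t \<in> stab"
proof -
  note d = one_parameter_subgroup_matrix_deriv(1)[OF c]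
  have c0: "c 0 = mat 1"
    using c by (simp add: one_parameter_subgroup_def)
  have pos: "c s \<in> stab" if "s \<ge> 0" for s
  proof (rule stab_ode[of "{}" 0 s c "\<lambda>_. Y"])
    show "continuous_on {0..s} c"
      by (meson d continuous_at_imp_continuous_on has_vector_derivative_continuous)
  qed (use that c0 Y d in \<open>auto intro: has_vector_derivative_at_within\<close>)
  show ?thesis
  proof (cases "t \<ge> 0")
    case False
    \<comment> \<open>\<open>stab_ode\<close> runs forward in time only; for negative t the matrix c
      t is the inverse of c (-t), which is already known to lie in \<open>stab\<close>.\<close>
    have e: "c (-t) *v (c t *v x) = x" for x
      using c unfolding one_parameter_subgroup_def
      by (metis add.left_inverse matrix_vector_mul_assoc matrix_vector_mul_lid)
    have "(c (-t) *v x) \<bullet> (c (-t) *v y) = x \<bullet> y"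
      "Upsilon0 (c (-t) *v x) (c (-t) *v y) (c (-t) *v z) = Upsilon0 x y z" for x y z
      using pos[of "-t"] False by (simp_all add: stab_def)
    from this(1)[of "c t *v x" "c t *v y" for x y] this(2)[of "c t *v x" "c t *v y" "c t *v z" for x y z]
    show ?thesis
      by (simp add: stab_def e)
  qed (use pos in simp)
qed

section \<open>Generation of the stabilizer by rotations about two axes\<close>

lemma Y_in_so3_ir [simp]: "Y1 \<in> so3_ir" "Y2 \<in> so3_ir" "Y3 \<in> so3_ir"
  by (simp_all add: so3_ir_def span_base)

lemma R_in_stab: "R1 t \<in> stab" "R2 t \<in> stab" "R3 t \<in> stab"
  using one_parameter_subgroup_R[THEN one_parameter_subgroup_stab] by auto

lemma SO3_ir_subset_stab: "SO3_ir \<subseteq> stab"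
proof
  fix A assume "A \<in> SO3_ir"
  then show "A \<in> stab"
    by induction (simp_all add: stab_mult one_parameter_subgroup_stab)
qed

text \<open>New factors enter on the left, as they do when a path is prolonged and its parallel
  transport is composed with that of the new segment.\<close>

inductive_set R12 :: "(real^5^5) set" where
  one: "mat 1 \<in> R12"
| R1: "A \<in> R12 \<Longrightarrow> R1 t ** A \<in> R12"
| R2: "A \<in> R12 \<Longrightarrow> R2 t ** A \<in> R12"

lemma R12_mult:
  assumes "A \<in> R12" "B \<in> R12"
  shows "A ** B \<in> R12"
  using assms(1) by induction (auto simp: assms(2) intro: R12.intros simp flip: matrix_mul_assoc)

lemma R12_R1: "R1 t \<in> R12" and R12_R2: "R2 t \<in> R12"
  using R12.R1[OF R12.one, of t] R12.R2[OF R12.one, of t] by simp_all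

text \<open>In SO(3), a quarter turn about one axis conjugates the rotations about a second axis
  into those about the third. So \<open>R1\<close> and \<open>R2\<close> suffice as
  generators.\<close>

lemma R3_eq: "R3 t = R1 (- pi / 2) ** R2 (- t) ** R1 (pi / 2)"
  by (rule matrix_eqI) (simp add: R1_mult R2_mult R3_mult Let_def vec5_eq_iff field_simps
      flip: matrix_vector_mul_assoc)

lemma R12_R3: "R3 t \<in> R12"
  unfolding R3_eq by (intro R12_mult R12_R1 R12_R2)

lemma R_inverse: "R1 (-t) ** (R1 t ** A) = A" "R2 (-t) ** (R2 t ** A) = A" "R3 (-t) ** (R3 t ** A) = A"
  "R1 t ** (R1 (-t) ** A) = A" "R2 t ** (R2 (-t) ** A) = A" "R3 t ** (R3 (-t) ** A) = A"
  by (simp_all add: matrix_mul_assoc flip: R1_add R2_add R3_add)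

text \<open>Turning back by the angle t lands on the point (-r, 0) with -r \<le> 0, the side that
  \<open>Veronese_arc\<close> asks for.\<close>

lemma polar_neg: "\<exists>r t. r \<ge> 0 \<and> x = - r * cos t \<and> y = - r * sin t"
  for x y :: real
proof -
  obtain r t where *: "x = r * cos t" "y = r * sin t"
    using polar_Ex by blast
  show ?thesis
  proof (cases "r \<ge> 0")
    case True
    then show ?thesis using * by (intro exI[of _ r] exI[of _ "t + pi"]) simp
  next
    case False
    then show ?thesis using * by (intro exI[of _ "-r"] exI[of _ t]) simp
  qed
qed

text \<open>Orthogonality gives injectivity, hence surjectivity in finite dimension. Solving for a
  preimage replaces computing with an inverse matrix when invariance is tested against an arbitrary
  vector.\<close>

lemma stab_inverse_image:
  assumes "A \<in> stab"
  obtains y where "A *v y = w"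
proof -
  have "inj ((*v) A)"
  proof (rule injI)
    fix x y assume "A *v x = A *v y"
    then have "(x - y) \<bullet> (x - y) = 0"
      using assms unfolding stab_def by (smt (verit) inner_zero_left matrix_vector_mult_diff_distrib mem_Collect_eq right_minus_eq)
    then show "x = y" by simp
  qed
  then have "surj ((*v) A)"
    by (simp add: linear_injective_imp_surjective)
  then show ?thesis using that by (metis surjD)
qed

text \<open>The vectors with \<open>\<Upsilon>(v, v, \<cdot>) = g(v, \<cdot>)\<close> form a Veronese surface, on which \<open>SO(3)\<close> acts
  transitively; the sign condition on \<open>v $ 4\<close> selects the arc through \<open>e\<^sub>1\<close> that \<open>R1\<close> traces out.\<close>
lemma Veronese_arc:
  assumes crit: "\<And>w. Upsilon0 v v w = v \<bullet> w" and norm: "v \<bullet> v = 1" and v: "v $ 5 = 0" "v $ 4 \<le> 0"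
  obtains b where "R1 b *v v = axis 1 1"
proof -
  have e1: "(v $ 1)\<^sup>2 + ((v $ 2)\<^sup>2 + (v $ 3)\<^sup>2) / 2 - (v $ 4)\<^sup>2 = v $ 1"
    using crit[of "axis 1 1"] v by (simp add: Upsilon0_def inner_5 power2_eq_square field_simps)
  have e2: "v $ 2 * (v $ 1 - sqrt 3 * v $ 4) = v $ 2"
    using crit[of "axis 2 1"] v by (simp add: Upsilon0_def inner_5 power2_eq_square field_simps)
  have e3: "v $ 3 * (v $ 1 + sqrt 3 * v $ 4) = v $ 3"
    using crit[of "axis 3 1"] v by (simp add: Upsilon0_def inner_5 power2_eq_square field_simps)
  have e4: "v $ 4 * (1 + 2 * v $ 1) = - sqrt 3 / 2 * ((v $ 2)\<^sup>2 - (v $ 3)\<^sup>2)"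
    using crit[of "axis 4 1"] v by (simp add: Upsilon0_def inner_5 power2_eq_square field_simps)
  have e5: "v $ 2 * v $ 3 = 0"
    using crit[of "axis 5 1"] v by (simp add: Upsilon0_def inner_5 power2_eq_square field_simps)
  have n: "(v $ 1)\<^sup>2 + (v $ 2)\<^sup>2 + (v $ 3)\<^sup>2 + (v $ 4)\<^sup>2 = 1"
    using norm v by (simp add: inner_5 power2_eq_square)
  have v3: "v $ 3 = 0"
  proof (rule ccontr)
    assume 3: "v $ 3 \<noteq> 0"
    then have "v $ 1 = 1 - sqrt 3 * v $ 4"
      using e3 by simp
    moreover have "sqrt 3 * v $ 4 \<le> 0"
      using v by (simp add: mult_nonneg_nonpos)
    ultimately have "v $ 1 \<ge> 1" by linarith
    then have "(v $ 1)\<^sup>2 \<ge> 1" by simp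
    moreover have "(v $ 3)\<^sup>2 > 0" using 3 by simp
    ultimately show False using n zero_le_power2[of "v $ 2"] zero_le_power2[of "v $ 4"] by linarith
  qed
  \<comment> \<open>Half of the left side is the coordinate \<open>n\<close> that \<open>R1\<close>
    fixes, and it equals 1/2 at e_1: this is the affine hyperplane containing the orbit of e_1 under
    \<open>R1\<close>.\<close>
  have a: "v $ 1 - sqrt 3 * v $ 4 = 1"
  proof (cases "v $ 2 = 0")
    case True
    then have "v $ 4 = 0 \<or> v $ 1 = - 1 / 2"
      using e4 v3 by auto
    then show ?thesis
    proof
      assume "v $ 4 = 0"
      then show ?thesis using e1 n True v3 by simp
    next
      assume 1: "v $ 1 = - 1 / 2"
      then have "(v $ 4)\<^sup>2 = 3 / 4"
        using n True v3 by (simp add: power2_eq_square)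
      then have "(2 * v $ 4)\<^sup>2 = (sqrt 3)\<^sup>2" by (simp add: power_mult_distrib)
      \<comment> \<open>The other root, \<open>v $ 4 = sqrt 3 / 2\<close>, belongs to the orbit of
        e_1 under \<open>R2\<close>; the sign condition excludes it.\<close>
      then have "2 * v $ 4 = - sqrt 3"
        using v(2) real_sqrt_unique[of "- 2 * v $ 4" 3] by simp
      then have "v $ 4 = - sqrt 3 / 2" by simp
      then show ?thesis using 1 by simp
    qed
  qed (use e2 in simp)
  \<comment> \<open>The remaining coordinates (f, \<open>v $ 2\<close>) lie on a circle of radius
    sqrt 3 / 2 about 0. \<open>R1\<close> turns it at double speed, so half of the polar angle
    brings v to e_1.\<close>
  define f where "f = (sqrt 3 * v $ 1 + v $ 4) / 2"
  have f1: "v $ 1 = (1 + 2 * sqrt 3 * f) / 4" "v $ 4 = (2 * f - sqrt 3) / 4"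
    using a by (simp_all add: f_def field_simps)
  have "f\<^sup>2 + (v $ 2)\<^sup>2 = 3 / 4"
    using n v3 by (simp add: f1 power2_eq_square field_simps)
  then have "(2 * f / sqrt 3)\<^sup>2 + (2 * v $ 2 / sqrt 3)\<^sup>2 = 1"
    by (simp add: power_divide power_mult_distrib)
  then obtain t where "2 * f / sqrt 3 = cos t" "2 * v $ 2 / sqrt 3 = sin t"
    using sincos_total_2pi by metis
  then have t: "f = sqrt 3 / 2 * cos t" "v $ 2 = sqrt 3 / 2 * sin t"
    by (simp_all add: field_simps)
  have cs: "cos t * cos t + sin t * sin t = 1"
    by (metis power2_eq_square sin_cos_squared_add2)
  have "cos t * f + sin t * v $ 2 = sqrt 3 / 2 * (cos t * cos t + sin t * sin t)"
    unfolding t distrib_left by (simp only: ac_simps)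
  moreover have "cos t * v $ 2 - sin t * f = 0"
    by (simp add: t)
  ultimately have g: "cos t * f + sin t * v $ 2 = sqrt 3 / 2" "cos t * v $ 2 - sin t * f = 0"
    by (simp_all only: cs mult_1_right)
  have "R1 (t / 2) *v v = axis 1 1"
    by (simp add: R1_mult Let_def vec5_eq_iff v v3 a g flip: f_def)
  then show ?thesis by (rule that)
qed

text \<open>The contraction of \<Upsilon> with e_1 has eigenvalues 1, 1/2, -1 on the spans of e_1,
  of e_2, e_3 and of e_4, e_5, so B preserves the middle plane. Once a rotation \<open>R3\<close>
  has made e_2 fixed, only the sign of the image of e_3 is free, and \<Upsilon> determines the
  images of e_4 and e_5. The stabilizer of e_1 is thus a copy of O(2).\<close>

lemma stab_fix_axis1:
  assumes "B \<in> stab" and fix1: "B *v axis 1 1 = axis 1 1"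
  shows "B \<in> R12"
proof -
  have orth: "(B *v x) \<bullet> (B *v y) = x \<bullet> y" and inv: "Upsilon0 (B *v x) (B *v y) (B *v z) = Upsilon0 x y z" for x y z
    using assms(1) by (auto simp: stab_def)
  have plane: "(B *v x) $ 1 = 0 \<and> (B *v x) $ 4 = 0 \<and> (B *v x) $ 5 = 0"
    if x: "x $ 1 = 0" "x $ 4 = 0" "x $ 5 = 0" and B: "B \<in> stab" "B *v axis 1 1 = axis 1 1" for x B
  proof -
    have *: "Upsilon0 (axis 1 1) (B *v x) w = (B *v x) \<bullet> w / 2" for w
    proof -
      obtain y where y: "B *v y = w" using stab_inverse_image[OF B(1)] .
      have "Upsilon0 (axis 1 1) (B *v x) w = Upsilon0 (axis 1 1) x y"
        using B y unfolding stab_def mem_Collect_eq by metis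
      also have "\<dots> = x \<bullet> y / 2"
        using x by (simp add: Upsilon0_def inner_5)
      also have "\<dots> = (B *v x) \<bullet> w / 2"
        using B(1) y unfolding stab_def by auto
      finally show ?thesis .
    qed
    show ?thesis
      using *[of "axis 1 1"] *[of "axis 4 1"] *[of "axis 5 1"] by (simp add: Upsilon0_def inner_5)
  qed
  define w where "w = B *v axis 2 1"
  have w: "w $ 1 = 0" "w $ 4 = 0" "w $ 5 = 0"
    using plane[of "axis 2 1" B] assms by (simp_all add: w_def)
  have "w \<bullet> w = 1"
    unfolding w_def orth by (simp add: inner_5)
  then have "(w $ 2)\<^sup>2 + (w $ 3)\<^sup>2 = 1"
    using w by (simp add: inner_5 power2_eq_square)
  then obtain t where t: "w $ 2 = cos t" "w $ 3 = sin t"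
    using sincos_total_2pi by metis
  \<comment> \<open>\<open>R3 t\<close> maps e_2 to its image under B, so C fixes both e_1 and
    e_2.\<close>
  define C where "C = R3 (-t) ** B"
  have C: "C \<in> stab" unfolding C_def by (intro stab_mult R_in_stab assms)
  have orth: "(C *v x) \<bullet> (C *v y) = x \<bullet> y" and inv: "Upsilon0 (C *v x) (C *v y) (C *v z) = Upsilon0 x y z" for x y z
    using C by (auto simp: stab_def)
  have C1: "C *v axis 1 1 = axis 1 1"
    by (simp add: C_def fix1 R3_mult vec5_eq_iff flip: matrix_vector_mul_assoc)
  have C2: "C *v axis 2 1 = axis 2 1"
    using sin_cos_squared_add2[of t]
    by (simp add: C_def R3_mult vec5_eq_iff w t power2_eq_square flip: matrix_vector_mul_assoc w_def)
  define z where "z = C *v axis 3 1"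
  have z: "z $ 1 = 0" "z $ 4 = 0" "z $ 5 = 0"
    using plane[of "axis 3 1" C] C C1 by (simp_all add: z_def)
  have z2: "z $ 2 = 0"
    using orth[of "axis 3 1" "axis 2 1"] by (simp add: C2 inner_5 flip: z_def)
  have "z $ 3 * z $ 3 = 1"
    using orth[of "axis 3 1" "axis 3 1"] z z2 by (simp add: inner_5 flip: z_def)
  then have z3: "z $ 3 = 1 \<or> z $ 3 = -1"
    by (simp add: square_eq_1_iff)
  have zax: "C *v axis 3 1 = z $ 3 *\<^sub>R axis 3 1"
    using z z2 by (simp add: vec5_eq_iff flip: z_def)
  \<comment> \<open>\<Upsilon>(e_2, e_2, y) = y_1 / 2 - sqrt 3 / 2 y_4, and e_1, e_2 are fixed, so
    the functional y_4 is fixed as well.\<close>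
  have C4: "C *v axis 4 1 = axis 4 1"
  proof -
    have "(C *v axis 4 1) $ i = axis 4 1 $ i" for i
    proof -
      obtain y where y: "C *v y = axis i 1" using stab_inverse_image[OF C] .
      have "axis 4 1 \<bullet> y = axis 4 1 \<bullet> (axis i 1 :: real^5)"
      proof -
        have "Upsilon0 (axis 2 1) (axis 2 1) y = Upsilon0 (axis 2 1) (axis 2 1) (axis i 1)"
          using inv[of "axis 2 1" "axis 2 1" y] by (simp add: C2 y)
        moreover have "axis 1 1 \<bullet> y = axis 1 1 \<bullet> (axis i 1 :: real^5)"
          using orth[of "axis 1 1" y] by (simp add: C1 y)
        ultimately show ?thesis by (simp add: Upsilon0_def inner_5)
      qed
      then show ?thesis
        using orth[of "axis 4 1" y] by (simp add: y inner_axis)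
    qed
    then show ?thesis by (simp add: vec_eq_iff)
  qed
  \<comment> \<open>\<Upsilon>(e_2, e_3, y) = - sqrt 3 / 2 y_5, so e_5 inherits the sign of
    e_3.\<close>
  have C5: "C *v axis 5 1 = z $ 3 *\<^sub>R axis 5 1"
  proof -
    have "(C *v axis 5 1) $ i = z $ 3 * axis 5 1 $ i" for i
    proof -
      obtain y where y: "C *v y = axis i 1" using stab_inverse_image[OF C] .
      have "Upsilon0 (axis 2 1) (z $ 3 *\<^sub>R axis 3 1) (axis i 1) = Upsilon0 (axis 2 1) (axis 3 1) y"
        using inv[of "axis 2 1" "axis 3 1" y] by (simp add: C2 y zax)
      then have "z $ 3 * (axis 5 1 \<bullet> axis i (1::real)) = axis 5 1 \<bullet> y"
        by (simp add: Upsilon0_def inner_5 mult.commute)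
      then show ?thesis
        using orth[of "axis 5 1" y] by (simp add: y inner_axis mult.commute)
    qed
    then show ?thesis by (simp add: vec_eq_iff)
  qed
  \<comment> \<open>The half turn \<open>R1 pi\<close> fixes e_1, e_2, e_4 and reverses e_3,
    e_5.\<close>
  have "C = R1 (if z $ 3 = 1 then 0 else pi)"
  proof -
    have "column j C = column j (R1 (if z $ 3 = 1 then 0 else pi))" for j
      using exhaust_5[of j] z3
      by (auto simp: C1 C2 zax C4 C5 R1_mult vec5_eq_iff Let_def simp flip: matrix_vector_mult_basis)
    then show ?thesis by (metis (no_types, lifting) matrix_eqI matrix_mult_sum sum.cong)
  qed
  then have "C \<in> R12" by (simp add: R12_R1)
  then show ?thesis
    using R12_mult[OF R12_R3[of t] \<open>C \<in> R12\<close>] by (simp add: C_def R_inverse)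
qed

lemma stab_subset_R12: "stab \<subseteq> R12"
proof
  fix A assume A: "A \<in> stab"
  define u where "u = A *v axis 1 1"
  obtain r t where r: "r \<ge> 0" "u $ 4 = - r * cos t" "u $ 5 = - r * sin t"
    using polar_neg by blast
  \<comment> \<open>\<open>R3\<close> turns the plane of e_4 and e_5 at double speed; half of the
    angle makes the e_5 coordinate of the image of e_1 vanish and its e_4 coordinate equal to
    -r.\<close>
  define B where "B = R3 (- t / 2) ** A"
  define v where "v = B *v axis 1 1"
  have B: "B \<in> stab" unfolding B_def by (intro stab_mult R_in_stab A)
  have crit: "Upsilon0 v v w = v \<bullet> w" for w
  proof -
    obtain y where y: "B *v y = w" using stab_inverse_image[OF B] .
    have "Upsilon0 v v w = Upsilon0 (axis 1 1) (axis 1 1) y" "v \<bullet> w = axis 1 1 \<bullet> y"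
      using B unfolding stab_def v_def y[symmetric] by auto
    then show ?thesis by (simp add: Upsilon0_def inner_5)
  qed
  have norm: "v \<bullet> v = 1"
    using B unfolding stab_def v_def by (simp add: inner_5)
  have v_eq: "v = R3 (- t / 2) *v u"
    by (simp add: v_def B_def u_def matrix_vector_mul_assoc)
  have cs: "cos t * cos t = 1 - sin t * sin t"
    by (metis power2_eq_square sin_cos_squared_add2 add_diff_cancel_right')
  have "v $ 4 = - r"
    by (simp add: v_eq R3_mult r cs algebra_simps)
  then have "v $ 5 = 0" "v $ 4 \<le> 0"
    using r by (simp_all add: v_eq R3_mult)
  then obtain b where b: "R1 b *v v = axis 1 1"
    using Veronese_arc[OF crit norm] by blast
  have "R1 b ** B \<in> R12"
    by (rule stab_fix_axis1) (simp_all add: stab_mult R_in_stab B b flip: matrix_vector_mul_assoc v_def)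
  then have "R3 (t / 2) ** (R1 (-b) ** (R1 b ** B)) \<in> R12"
    by (rule R12_mult[OF R12_R3 R12_mult[OF R12_R1]])
  then show "A \<in> R12"
    using R_inverse(6)[of "t / 2" A] by (simp add: R_inverse B_def)
qed

lemma SO3_ir_mult:
  assumes "A \<in> SO3_ir" "B \<in> SO3_ir"
  shows "A ** B \<in> SO3_ir"
  using assms(2) by induction (use assms(1) in \<open>auto intro: SO3_ir.mult simp: matrix_mul_assoc\<close>)

lemma R_in_SO3_ir: "R1 t \<in> SO3_ir" "R2 t \<in> SO3_ir"
  using SO3_ir.mult[OF SO3_ir.one _ one_parameter_subgroup_R(1), of t]
    SO3_ir.mult[OF SO3_ir.one _ one_parameter_subgroup_R(2), of t] by simp_all

lemma R12_subset_SO3_ir: "R12 \<subseteq> SO3_ir"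
proof
  fix A assume "A \<in> R12"
  then show "A \<in> SO3_ir"
    by induction (auto intro: SO3_ir.one SO3_ir_mult R_in_SO3_ir)
qed

lemma SO3_ir_eq_stab: "SO3_ir = stab" and SO3_ir_eq_R12: "SO3_ir = R12"
  using SO3_ir_subset_stab stab_subset_R12 R12_subset_SO3_ir by auto

section \<open>Uniqueness of the tensor\<close>

lemma is_Upsilon_Upsilon0: "is_Upsilon Upsilon0"
  unfolding is_Upsilon_def
proof (intro conjI allI ballI)
  fix v :: "real^5"
  show "contract Upsilon0 v (contract Upsilon0 v v) = (v \<bullet> v) *\<^sub>R v"
    by (simp add: vec5_eq_iff contract_def Upsilon0_def inner_5 field_simps)
next
  fix A x y z assume "A \<in> SO3_ir"
  then show "Upsilon0 (A *v x) (A *v y) (A *v z) = Upsilon0 x y z"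
    using SO3_ir_subset_stab by (auto simp: stab_def)
qed (use Upsilon0_linear Upsilon0_sym in blast)+

lemma trilinear_eq_axis:
  fixes U V :: tensor3
  assumes U: "\<And>y z. linear (\<lambda>x. U x y z)" "\<And>x z. linear (\<lambda>y. U x y z)" "\<And>x y. linear (\<lambda>z. U x y z)"
    and V: "\<And>y z. linear (\<lambda>x. V x y z)" "\<And>x z. linear (\<lambda>y. V x y z)" "\<And>x y. linear (\<lambda>z. V x y z)"
    and eq: "\<And>i j k. U (axis i 1) (axis j 1) (axis k 1) = V (axis i 1) (axis j 1) (axis k 1)"
  shows "U x y z = V x y z"
proof -
  have *: "f = g" if "linear f" "linear g" "\<And>i. f (axis i 1) = g (axis i 1)" for f g :: "real^5 \<Rightarrow> real"
    by (rule linear_eq_stdbasis[OF that(1,2)]) (use that(3) in \<open>auto simp: Basis_vec_def\<close>)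
  have "U (axis i 1) (axis j 1) z = V (axis i 1) (axis j 1) z" for i j z
    using *[OF U(3) V(3), of "axis i 1" "axis j 1" "axis i 1" "axis j 1"] eq by metis
  then have "U (axis i 1) y z = V (axis i 1) y z" for i y z
    using *[OF U(2) V(2), of "axis i 1" z "axis i 1" z] by metis
  then show ?thesis
    using *[OF U(1) V(1), of y z y z] by metis
qed

text \<open>Differentiating the invariance along one-parameter subgroups gives linear equations for
  the components of U. They leave the single constant k = U(e_1, e_1, e_1), and the normalization at
  e_1 yields k * k = 1.\<close>

lemma is_Upsilon_unique:
  assumes "is_Upsilon U"
  shows "U = Upsilon0 \<or> U = (\<lambda>x y z. - Upsilon0 x y z)"
proof -
  have sym: "U x y z = U y x z" "U x y z = U x z y" for x y z
    using assms unfolding is_Upsilon_def by blast+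
  have lin: "linear (\<lambda>x. U x y z)" "linear (\<lambda>y. U x y z)" "linear (\<lambda>z. U x y z)" for x y z
  proof -
    show 1: "linear (\<lambda>x. U x y z)" for y z
      using assms unfolding is_Upsilon_def by blast
    show 2: "linear (\<lambda>y. U x y z)" for x z
      using 1 sym(1)[of x] by simp
    show "linear (\<lambda>z. U x y z)"
      using 2 sym(2)[of x y] by simp
  qed
  have inv: "U (Y *v x) y z + U x (Y *v y) z + U x y (Y *v z) = 0"
    if c: "one_parameter_subgroup (**) (mat 1) Y c" and Y: "Y \<in> so3_ir" for Y c x y z
  proof -
    have "c t \<in> SO3_ir" for t
      using SO3_ir.mult[OF SO3_ir.one Y c, of t] by simp
    then have "U (c t *v x) (c t *v y) (c t *v z) = U x y z" for t
      using assms unfolding is_Upsilon_def by blast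
    then have "((\<lambda>t. U (c t *v x) (c t *v y) (c t *v z)) has_real_derivative 0) (at 0)"
      by simp
    moreover have "(c has_vector_derivative Y) (at 0)" "c 0 = mat 1"
      using c by (auto simp: one_parameter_subgroup_def)
    note d = has_vector_derivative_mult_vec[OF this(1)] this(2)
    have "((\<lambda>t. U (c t *v x) (c t *v y) (c t *v z)) has_real_derivative
      U (Y *v x) y z + U x (Y *v y) z + U x y (Y *v z)) (at 0)"
      using trilinear_has_derivative[of U, OF lin d(1) d(1) d(1), of x y z] by (simp add: d(2))
    ultimately show ?thesis by (rule DERIV_unique[symmetric])
  qed
  note inv = inv[OF one_parameter_subgroup_R(1) Y_in_so3_ir(1)]
    inv[OF one_parameter_subgroup_R(2) Y_in_so3_ir(2)] inv[OF one_parameter_subgroup_R(3) Y_in_so3_ir(3)]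
  txt \<open>Rescaling the first basis vector makes the linear system rational.\<close>
  define w e2 e3 e4 e5 :: "real^5" where
    e: "w = sqrt 3 *\<^sub>R axis 1 1" "e2 = axis 2 1" "e3 = axis 3 1" "e4 = axis 4 1" "e5 = axis 5 1"
  have Y: "Y1 *v w = (-3) *\<^sub>R e2" "Y1 *v e2 = w + e4" "Y1 *v e3 = e5" "Y1 *v e4 = - e2" "Y1 *v e5 = - e3"
    "Y3 *v w = 0" "Y3 *v e2 = e3" "Y3 *v e3 = - e2" "Y3 *v e4 = 2 *\<^sub>R e5" "Y3 *v e5 = (-2) *\<^sub>R e4"
    by (simp_all add: e vec5_eq_iff Y1_mult Y3_mult)
  have l: "U (x + x') y z = U x y z + U x' y z" "U (r *\<^sub>R x) y z = r * U x y z" "U (- x) y z = - U x y z" "U 0 y z = 0"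
    "U y (x + x') z = U y x z + U y x' z" "U y (r *\<^sub>R x) z = r * U y x z" "U y (- x) z = - U y x z" "U y 0 z = 0"
    "U y z (x + x') = U y z x + U y z x'" "U y z (r *\<^sub>R x) = r * U y z x" "U y z (- x) = - U y z x" "U y z 0 = 0"
    for x x' y z r
    using linear_add[OF lin(1)] linear_add[OF lin(2)] linear_add[OF lin(3)]
      linear_scale[OF lin(1)] linear_scale[OF lin(2)] linear_scale[OF lin(3)]
      linear_neg[OF lin(1)] linear_neg[OF lin(2)] linear_neg[OF lin(3)]
      linear_0[OF lin(1)] linear_0[OF lin(2)] linear_0[OF lin(3)] by simp_all
  note I1 = inv(1)[of x y z for x y z] and I3 = inv(3)[of x y z for x y z]
  \<comment> \<open>\<open>Y3\<close> rotates with weight 0 on w, 1 on (e2, e3) and 2 on (e4, e5).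
    Only combinations of total weight 0 survive, which leaves five numbers: the components on www,
    we2e2, we4e4, e2e2e4 and e2e2e5.\<close>
  have z1: "U w w e2 = 0" "U w w e3 = 0" "U w w e4 = 0" "U w w e5 = 0"
    using I3[of w w e2] I3[of w w e3] I3[of w w e4] I3[of w w e5] by (simp_all add: Y l)
  have z2: "U w e2 e3 = 0" "U w e3 e3 = U w e2 e2" "U w e4 e5 = 0" "U w e5 e5 = U w e4 e4"
    using I3[of w e2 e2] I3[of w e2 e3] I3[of w e4 e4] I3[of w e4 e5]
    by (simp_all only: Y l sym) (linarith+)?
  have z3: "U w e2 e4 = 0" "U w e2 e5 = 0" "U w e3 e4 = 0" "U w e3 e5 = 0"
    using I3[of w e2 e4] I3[of w e2 e5] I3[of w e3 e4] I3[of w e3 e5]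
    by (simp_all only: Y l sym) (linarith+)?
  have z4: "U e2 e2 e2 = 0" "U e2 e2 e3 = 0" "U e2 e3 e3 = 0" "U e3 e3 e3 = 0"
    using I3[of e2 e2 e2] I3[of e2 e2 e3] I3[of e2 e3 e3] I3[of e3 e3 e3]
    by (simp_all only: Y l sym) (linarith+)?
  have z5: "U e4 e4 e4 = 0" "U e4 e4 e5 = 0" "U e4 e5 e5 = 0" "U e5 e5 e5 = 0"
    using I3[of e4 e4 e4] I3[of e4 e4 e5] I3[of e4 e5 e5] I3[of e5 e5 e5]
    by (simp_all only: Y l sym) (linarith+)?
  have z6: "U e2 e4 e4 = 0" "U e2 e4 e5 = 0" "U e2 e5 e5 = 0" "U e3 e4 e4 = 0" "U e3 e4 e5 = 0" "U e3 e5 e5 = 0"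
    using I3[of e2 e4 e4] I3[of e2 e4 e5] I3[of e2 e5 e5] I3[of e3 e4 e4] I3[of e3 e4 e5] I3[of e3 e5 e5]
    by (simp_all only: Y l sym) (linarith+)?
  have z7: "U e2 e3 e5 = U e2 e2 e4" "U e3 e3 e4 = - U e2 e2 e4" "U e2 e3 e4 = - U e2 e2 e5" "U e3 e3 e5 = - U e2 e2 e5"
    using I3[of e2 e2 e4] I3[of e2 e3 e4] I3[of e3 e3 e4] I3[of e2 e2 e5] I3[of e2 e3 e5] I3[of e3 e3 e5]
    by (simp_all only: Y l sym) (linarith+)?
  \<comment> \<open>\<open>Y1\<close> mixes the weights and ties the five numbers to
    \<open>U w w w\<close>.\<close>
  have z8: "U w e2 e2 = U w w w / 6" "U e2 e2 e4 = - U w w w / 6" "U w e4 e4 = - U w w w / 3" "U e2 e2 e5 = 0"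
    using I1[of w w e2] I1[of e2 e2 e2] I1[of w e2 e4] I1[of e2 e2 e3] z1 z2 z3 z4 z7
    by (simp_all only: Y l sym) (linarith+)?
  define k where "k = U (axis 1 1) (axis 1 1) (axis 1 1)"
  have w3: "U w w w = 3 * sqrt 3 * k" "U w y z = sqrt 3 * U (axis 1 1) y z" for y z
    by (simp_all add: e l k_def)
  have z0: "U (axis 1 1) (axis 1 1) e2 = 0" "U (axis 1 1) (axis 1 1) e3 = 0"
    "U (axis 1 1) (axis 1 1) e4 = 0" "U (axis 1 1) (axis 1 1) e5 = 0"
    using z1 by (simp_all add: e(1) l)
  have ww: "U (axis 1 1) w w = 3 * k"
    by (simp add: e(1) l k_def)
  have z9: "U (axis 1 1) e2 e2 = k / 2" "U e2 e2 e4 = - sqrt 3 / 2 * k"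
    using z8 by (simp_all add: w3(2) ww)
  have "sqrt 3 * U (axis 1 1) e4 e4 = sqrt 3 * (- k)"
    using z8(3) by (simp add: w3(2) ww)
  then have z10: "U (axis 1 1) e4 e4 = - k"
    by (simp only: mult_cancel_left) simp
  note z = z0 z2[unfolded w3(2) mult_cancel_left] z3[unfolded w3(2) mult_eq_0_iff] z4 z5 z6 z7 z8(4) z9 z10
  have eq: "\<forall>i j m. U (axis i 1) (axis j 1) (axis m 1) = k * Upsilon0 (axis i 1) (axis j 1) (axis m 1)"
    using z unfolding forall_5 e by (simp add: Upsilon0_def k_def[symmetric] sym)
  have "U x y z = k * Upsilon0 x y z" for x y z
  proof (rule trilinear_eq_axis)
    show "linear (\<lambda>x. k * Upsilon0 x y z)" "linear (\<lambda>x. k * Upsilon0 y x z)" "linear (\<lambda>x. k * Upsilon0 y z x)" for y z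
      using linear_compose_scale_right[OF Upsilon0_linear(1), of k y z]
        linear_compose_scale_right[OF Upsilon0_linear(2), of k y z]
        linear_compose_scale_right[OF Upsilon0_linear(3), of k y z] by simp_all
  qed (use lin eq in auto)
  then have U: "U = (\<lambda>x y z. k * Upsilon0 x y z)" by blast
  have "contract U (axis 1 1) (contract U (axis 1 1) (axis 1 1)) = axis 1 1"
    using assms unfolding is_Upsilon_def by (simp add: inner_axis_axis)
  then have "k * k = 1"
    by (simp add: vec5_eq_iff U contract_def Upsilon0_def)
  then show ?thesis
    using U by (auto simp: square_eq_1_iff)
qed

section \<open>The Levi-Civita connection\<close>

text \<open>The argument behind the Koszul formula: the difference tensor is symmetric in its first
  two slots and skew in its last two, hence zero.\<close>

lemma metric_conn_unique:
  assumes "metric_conn L" "metric_conn L'"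
    and tor: "\<And>x y. L x *v y - L y *v x = L' x *v y - L' y *v x"
  shows "L = L'"
proof -
  define D where "D x y z = (L x *v y) \<bullet> z - (L' x *v y) \<bullet> z" for x y z
  have skew: "D x y z = - D x z y" for x y z
    using assms(1,2) unfolding metric_conn_def D_def
    by (metis (no_types, opaque_lifting) add_eq_0_iff inner_commute minus_diff_minus)
  have sym: "D x y z = D y x z" for x y z
  proof -
    have "(L x *v y - L y *v x) \<bullet> z = (L' x *v y - L' y *v x) \<bullet> z"
      by (simp add: tor)
    then show ?thesis by (simp add: D_def inner_diff_left)
  qed
  have "D x y z = 0" for x y z
    using skew[of x y z] sym[of x y z] skew[of y x z] sym[of y z x] skew[of z y x] sym[of z x y]
      sym[of x z y] by linarith
  then have "(L x *v y - L' x *v y) \<bullet> z = 0" for x y z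
    by (simp add: D_def inner_diff_left)
  then have "L x *v y = L' x *v y" for x y
    by (metis inner_eq_zero_iff right_minus_eq)
  then show ?thesis
    using matrix_eqI by blast
qed

text \<open>The choice operator leaves the sign open; near integrability, a vanishing condition
  linear in the tensor, does not see it.\<close>

lemma Upsilon_cases: "Upsilon = Upsilon0 \<or> Upsilon = (\<lambda>x y z. - Upsilon0 x y z)"
  unfolding Upsilon_def by (rule is_Upsilon_unique[OF someI[of is_Upsilon, OF is_Upsilon_Upsilon0]])

lemma scaleR_mult_vec: "(c *\<^sub>R A) *v x = c *\<^sub>R (A *v x)" for A :: "real^'n^'m"
  by (simp flip: scaleR_matrix_vector_assoc)

section \<open>Structure constants and the Levi-Civita connection of the homogeneous space\<close>

locale Wir_metric =
  fixes \<mu> \<alpha> \<beta> \<gamma> :: real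
  assumes pos: "\<alpha> > 0" "\<beta> > 0" "\<gamma> > 0"
begin

definition "p = \<mu> / sqrt \<alpha>"
definition "q = 1 / sqrt \<gamma>"
definition "r = \<mu> * sqrt \<alpha> / (\<gamma> * (1 + \<mu>\<^sup>2))"
definition "s = 1 / (\<gamma> * (1 + \<mu>\<^sup>2))"

lemma q_pos: "q > 0"
  using pos by (simp add: q_def)

lemma frame_eq: "frame \<mu> \<alpha> \<beta> \<gamma> z = (z $ 1 / sqrt \<alpha>,
      (\<chi> i. \<chi> k. if i = 1 then if k = 1 then z $ 5 / sqrt \<gamma> else z $ 4 / sqrt \<gamma> - \<mu> * z $ 1 / sqrt \<alpha>
        else if k = 1 then z $ 4 / sqrt \<gamma> + \<mu> * z $ 1 / sqrt \<alpha> else - (z $ 5 / sqrt \<gamma>)),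
      (\<chi> i. if i = 1 then z $ 3 / sqrt \<beta> else z $ 2 / sqrt \<beta>))"
  by (simp add: frame_def ebar1_def ebar2_def ebar3_def ebar4_def ebar5_def
      vec_eq_iff forall_2 Eplus_def Eminus_def X_mat_def zero_prod_def divide_inverse)

text \<open>Only [e_4, e_5] has a component in \<hh>: [E_+ + E_-, X] = -2 (E_+ - E_-), and (1 +
  \<mu>^2) (E_+ - E_-) is \<open>ebar0\<close> minus \<mu> times \<open>ebar1\<close>. This is the
  origin of \<open>s\<close> and \<open>r\<close>.\<close>

lemma lie_bracket_frame:
  "lie_bracket (frame \<mu> \<alpha> \<beta> \<gamma> x) (frame \<mu> \<alpha> \<beta> \<gamma> y) =
    (- 2 * s * (x $ 4 * y $ 5 - x $ 5 * y $ 4)) *\<^sub>R ebar0 \<mu> + frame \<mu> \<alpha> \<beta> \<gamma> (vec5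
      (2 * r * (x $ 4 * y $ 5 - x $ 5 * y $ 4))
      (p * (x $ 1 * y $ 3 - x $ 3 * y $ 1) + q * (x $ 4 * y $ 3 - x $ 3 * y $ 4) - q * (x $ 5 * y $ 2 - x $ 2 * y $ 5))
      (- p * (x $ 1 * y $ 2 - x $ 2 * y $ 1) + q * (x $ 4 * y $ 2 - x $ 2 * y $ 4) + q * (x $ 5 * y $ 3 - x $ 3 * y $ 5))
      (2 * p * (x $ 1 * y $ 5 - x $ 5 * y $ 1)) (- 2 * p * (x $ 1 * y $ 4 - x $ 4 * y $ 1)))"
    (is "?l = ?t *\<^sub>R _ + frame _ _ _ _ ?v")
proof -
  \<comment> \<open>Coordinates in the basis of the \<open>ebar\<close>'s, in which the bracket
    carries no square roots.\<close>
  define X where "X i = x $ i / sqrt (if i = 1 then \<alpha> else if i = 2 \<or> i = 3 then \<beta> else \<gamma>)" for i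
  define Y where "Y i = y $ i / sqrt (if i = 1 then \<alpha> else if i = 2 \<or> i = 3 then \<beta> else \<gamma>)" for i
  have m: "1 + \<mu>\<^sup>2 > 0" by (simp add: add_pos_nonneg)
  have x: "x $ 1 = sqrt \<alpha> * X 1" "x $ 2 = sqrt \<beta> * X 2" "x $ 3 = sqrt \<beta> * X 3" "x $ 4 = sqrt \<gamma> * X 4" "x $ 5 = sqrt \<gamma> * X 5"
    and y: "y $ 1 = sqrt \<alpha> * Y 1" "y $ 2 = sqrt \<beta> * Y 2" "y $ 3 = sqrt \<beta> * Y 3" "y $ 4 = sqrt \<gamma> * Y 4" "y $ 5 = sqrt \<gamma> * Y 5"
    using pos by (simp_all add: X_def Y_def)
  define j where "j = X 4 * Y 5 - X 5 * Y 4"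
  note F = frame_eq
  have g: "sqrt \<gamma> * (sqrt \<gamma> * z) = \<gamma> * z" for z
    using pos by (simp add: mult.assoc[symmetric] del: mult_cancel_right)
  have xy: "x $ 4 * y $ 5 - x $ 5 * y $ 4 = \<gamma> * j"
    by (simp add: x y j_def g algebra_simps)
  define k where "k = j / (1 + \<mu>\<^sup>2)"
  define V where "V = ?v"
  have t: "?t = - 2 * k"
    using pos by (simp add: xy s_def k_def)
  have v: "V $ 1 / sqrt \<alpha> = 2 * \<mu> * k"
    using pos by (simp add: V_def xy r_def k_def)
  have v': "V $ 2 / sqrt \<beta> = \<mu> * (X 1 * Y 3 - X 3 * Y 1) + (X 4 * Y 3 - X 3 * Y 4) - (X 5 * Y 2 - X 2 * Y 5)"
    "V $ 3 / sqrt \<beta> = - \<mu> * (X 1 * Y 2 - X 2 * Y 1) + (X 4 * Y 2 - X 2 * Y 4) + (X 5 * Y 3 - X 3 * Y 5)"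
    "V $ 4 / sqrt \<gamma> = 2 * \<mu> * (X 1 * Y 5 - X 5 * Y 1)"
    "V $ 5 / sqrt \<gamma> = - 2 * \<mu> * (X 1 * Y 4 - X 4 * Y 1)"
    using pos by (simp_all add: V_def p_def q_def x y g field_simps)
  \<comment> \<open>The division by 1 + \<mu>^2 stays hidden in k; substituting for
    \<open>X 4 * Y 5\<close> leaves a polynomial identity.\<close>
  have "k + \<mu> * (\<mu> * k) = k * (1 + \<mu>\<^sup>2)"
    by (simp add: algebra_simps power2_eq_square)
  then have j: "X 4 * Y 5 = X 5 * Y 4 + (k + \<mu> * (\<mu> * k))"
    using m by (simp add: k_def j_def)
  have "\<mu> * V $ 1 / sqrt \<alpha> = \<mu> * (2 * \<mu> * k)"
    unfolding v[symmetric] by simp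
  note v = v this v'
  have "(lie_bracket (frame \<mu> \<alpha> \<beta> \<gamma> x) (frame \<mu> \<alpha> \<beta> \<gamma> y)) = (- 2 * k) *\<^sub>R ebar0 \<mu> + frame \<mu> \<alpha> \<beta> \<gamma> V"
    unfolding F v using pos
    by (simp add: x y ebar0_def vec_eq_iff forall_2 Eplus_def Eminus_def matrix_matrix_mult_def
      matrix_vector_mult_def sum_2) (simp add: j algebra_simps)
  then show ?thesis
    unfolding t V_def .
qed

lemma bracket_eq:
  "bracket_m \<mu> \<alpha> \<beta> \<gamma> x y = vec5
      (2 * r * (x $ 4 * y $ 5 - x $ 5 * y $ 4))
      (p * (x $ 1 * y $ 3 - x $ 3 * y $ 1) + q * (x $ 4 * y $ 3 - x $ 3 * y $ 4) - q * (x $ 5 * y $ 2 - x $ 2 * y $ 5))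
      (- p * (x $ 1 * y $ 2 - x $ 2 * y $ 1) + q * (x $ 4 * y $ 2 - x $ 2 * y $ 4) + q * (x $ 5 * y $ 3 - x $ 3 * y $ 5))
      (2 * p * (x $ 1 * y $ 5 - x $ 5 * y $ 1)) (- 2 * p * (x $ 1 * y $ 4 - x $ 4 * y $ 1))"
  and h_coord_bracket: "h_coord \<mu> \<alpha> \<beta> \<gamma> (lie_bracket (frame \<mu> \<alpha> \<beta> \<gamma> x) (frame \<mu> \<alpha> \<beta> \<gamma> y)) =
    - 2 * s * (x $ 4 * y $ 5 - x $ 5 * y $ 4)"
proof -
  have "t *\<^sub>R ebar0 \<mu> + frame \<mu> \<alpha> \<beta> \<gamma> z \<in> G_lie" for t z
    by (simp add: frame_def G_lie_def ebar0_def ebar1_def ebar2_def ebar3_def ebar4_def ebar5_def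
        trace_def sum_2 Eplus_def Eminus_def X_mat_def zero_prod_def)
  note c = coord_eq[OF pos this]
  show "bracket_m \<mu> \<alpha> \<beta> \<gamma> x y = vec5
      (2 * r * (x $ 4 * y $ 5 - x $ 5 * y $ 4))
      (p * (x $ 1 * y $ 3 - x $ 3 * y $ 1) + q * (x $ 4 * y $ 3 - x $ 3 * y $ 4) - q * (x $ 5 * y $ 2 - x $ 2 * y $ 5))
      (- p * (x $ 1 * y $ 2 - x $ 2 * y $ 1) + q * (x $ 4 * y $ 2 - x $ 2 * y $ 4) + q * (x $ 5 * y $ 3 - x $ 3 * y $ 5))
      (2 * p * (x $ 1 * y $ 5 - x $ 5 * y $ 1)) (- 2 * p * (x $ 1 * y $ 4 - x $ 4 * y $ 1))"
    "h_coord \<mu> \<alpha> \<beta> \<gamma> (lie_bracket (frame \<mu> \<alpha> \<beta> \<gamma> x) (frame \<mu> \<alpha> \<beta> \<gamma> y)) =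
    - 2 * s * (x $ 4 * y $ 5 - x $ 5 * y $ 4)"
    unfolding bracket_m_def lie_bracket_frame c by simp_all
qed

text \<open>The result of the Koszul formula for the brackets in \<open>bracket_eq\<close>.\<close>

definition lc :: conn where
  "lc x = x $ 1 *\<^sub>R (- p *\<^sub>R Eij 2 3 - (2 * p + r) *\<^sub>R Eij 4 5) + x $ 2 *\<^sub>R (- q *\<^sub>R Eij 2 5 + q *\<^sub>R Eij 3 4)
    + x $ 3 *\<^sub>R (q *\<^sub>R Eij 2 4 + q *\<^sub>R Eij 3 5) - (r * x $ 4) *\<^sub>R Eij 1 5 + (r * x $ 5) *\<^sub>R Eij 1 4"

lemma lc_mult: "lc x *v y = vec5 (r * (x $ 4 * y $ 5 - x $ 5 * y $ 4))
    (p * (x $ 1 * y $ 3) + q * (x $ 2 * y $ 5 - x $ 3 * y $ 4))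
    (- p * (x $ 1 * y $ 2) - q * (x $ 2 * y $ 4 + x $ 3 * y $ 5))
    ((2 * p + r) * (x $ 1 * y $ 5) + q * (x $ 2 * y $ 3 + x $ 3 * y $ 2) + r * (x $ 5 * y $ 1))
    (- (2 * p + r) * (x $ 1 * y $ 4) - q * (x $ 2 * y $ 2 - x $ 3 * y $ 3) - r * (x $ 4 * y $ 1))"
  by (simp add: vec5_eq_iff lc_def matrix_vector_mult_def sum_5 Eij_def algebra_simps)

lemma levi_civita_eq: "levi_civita \<mu> \<alpha> \<beta> \<gamma> = lc"
  unfolding levi_civita_def
proof (rule the_equality)
  have "linear lc"
    by (rule linearI; rule matrix_eqI)
      (simp_all add: lc_mult vec5_eq_iff scaleR_mult_vec algebra_simps)
  moreover have "metric_conn lc"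
    by (simp add: metric_conn_def lc_mult inner_5 algebra_simps)
  moreover have tor: "torsion \<mu> \<alpha> \<beta> \<gamma> lc x y = 0" for x y
    by (simp add: torsion_def bracket_eq lc_mult vec5_eq_iff algebra_simps)
  ultimately show "linear lc \<and> metric_conn lc \<and> (\<forall>x y. torsion \<mu> \<alpha> \<beta> \<gamma> lc x y = 0)" by blast
  show "L = lc" if "linear L \<and> metric_conn L \<and> (\<forall>x y. torsion \<mu> \<alpha> \<beta> \<gamma> L x y = 0)" for L
    by (rule metric_conn_unique) (use that \<open>metric_conn lc\<close> tor in \<open>auto simp: torsion_def\<close>)
qed

text \<open>The terms of \<open>lc\<close> with p form a multiple of \<open>Y3\<close>, which
  annihilates \<Upsilon>. The rest gives (3 q - sqrt 3 r) v_1 ((v_2^2 - v_3^2) v_5 - 2 v_2 v_3 v_4),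
  and the test vector e_1 + e_2 + e_5 makes the factor after the bracket in q and r equal to
  1.\<close>

lemma nearly_integrable_iff: "nearly_integrable \<mu> \<alpha> \<beta> \<gamma> \<longleftrightarrow> r = sqrt 3 * q"
proof -
  have *: "cov_deriv lc Upsilon v v v v = 0 \<longleftrightarrow> Upsilon0 (lc v *v v) v v = 0" for v
  proof -
    have "Upsilon0 v w v = Upsilon0 w v v" "Upsilon0 v v w = Upsilon0 w v v" for w
      by (metis Upsilon0_sym)+
    note U = this
    from Upsilon_cases show ?thesis
    proof
      assume 1: "Upsilon = Upsilon0"
      show ?thesis by (simp add: cov_deriv_def 1 U)
    next
      assume 1: "Upsilon = (\<lambda>x y z. - Upsilon0 x y z)"
      show ?thesis by (simp add: cov_deriv_def 1 U)
    qed
  qed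
  show ?thesis
    unfolding nearly_integrable_def levi_civita_eq *
  proof
    assume "\<forall>v. Upsilon0 (lc v *v v) v v = 0"
    from spec[OF this, of "vec5 1 1 0 0 1"] have "sqrt 3 * r = 3 * q"
      by (simp add: lc_mult Upsilon0_def algebra_simps)
    then have "sqrt 3 * (sqrt 3 * r) = sqrt 3 * (3 * q)" by simp
    then show "r = sqrt 3 * q" by simp
  next
    assume r: "r = sqrt 3 * q"
    show "\<forall>v. Upsilon0 (lc v *v v) v v = 0"
      by (simp add: lc_mult Upsilon0_def r field_simps)
  qed
qed

section \<open>Natural reductivity and the Einstein condition\<close>

lemma not_naturally_reductive: "\<not> naturally_reductive \<mu> \<alpha> \<beta> \<gamma>"
proof
  assume "naturally_reductive \<mu> \<alpha> \<beta> \<gamma>"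
  \<comment> \<open>E_+ + E_- acts on the plane of e_2 and e_3 by a symmetric matrix instead of a
    skew one.\<close>
  then have "bracket_m \<mu> \<alpha> \<beta> \<gamma> (axis 4 1) (axis 2 1) \<bullet> axis 3 1
      = - (bracket_m \<mu> \<alpha> \<beta> \<gamma> (axis 4 1) (axis 3 1) \<bullet> axis 2 1)"
    unfolding naturally_reductive_def by blast
  then show False
    using q_pos by (simp add: bracket_eq inner_5)
qed

lemma ricci_eq: "ricci \<mu> \<alpha> \<beta> \<gamma> (axis 1 1) (axis 1 1) = 2 * r\<^sup>2" "ricci \<mu> \<alpha> \<beta> \<gamma> (axis 2 1) (axis 2 1) = 0"
proof -
  have c: "curvature \<mu> \<alpha> \<beta> \<gamma> lc z x *v y = lc z *v (lc x *v y) - lc x *v (lc z *v y)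
     + (2 * s * (z $ 4 * x $ 5 - z $ 5 * x $ 4)) *\<^sub>R (Y3 *v y) - lc (bracket_m \<mu> \<alpha> \<beta> \<gamma> z x) *v y" for x y z
    unfolding curvature_def conn_ext_def h_coord_bracket isotropy_eq[OF pos] bracket_m_def[symmetric] Y3_def[symmetric]
    by (simp add: matrix_vector_mult_diff_rdistrib matrix_vector_mult_add_rdistrib scaleR_mult_vec matrix_vector_mul_assoc)
  have "ricci \<mu> \<alpha> \<beta> \<gamma> x y = (\<Sum>i\<in>UNIV. (curvature \<mu> \<alpha> \<beta> \<gamma> lc (axis i 1) x *v y) $ i)" for x y
    by (simp add: ricci_def levi_civita_eq trace_def matrix_def)
  note ric = this[unfolded sum_5 c bracket_eq lc_mult Y3_mult]
  show "ricci \<mu> \<alpha> \<beta> \<gamma> (axis 1 1) (axis 1 1) = 2 * r\<^sup>2" "ricci \<mu> \<alpha> \<beta> \<gamma> (axis 2 1) (axis 2 1) = 0"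
    unfolding ric by (simp_all add: algebra_simps power2_eq_square)
qed

lemma not_einstein:
  assumes "r \<noteq> 0"
  shows "\<not> einstein \<mu> \<alpha> \<beta> \<gamma>"
proof
  assume "einstein \<mu> \<alpha> \<beta> \<gamma>"
  then obtain c where c: "ricci \<mu> \<alpha> \<beta> \<gamma> x y = c * (x \<bullet> y)" for x y
    unfolding einstein_def by blast
  show False
    using c[of "axis 1 1" "axis 1 1"] c[of "axis 2 1" "axis 2 1"] assms
    by (simp add: ricci_eq inner_5)
qed

end

section \<open>Isotropy and the characteristic connection\<close>

lemma matrix_inv_unique:
  fixes A B :: "real^'n^'n"
  assumes "A ** B = mat 1" "B ** A = mat 1"
  shows "matrix_inv A = B"
  unfolding matrix_inv_def
proof (rule some_equality)
  show "B' = B" if "A ** B' = mat 1 \<and> B' ** A = mat 1" for B'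
    using that assms by (metis matrix_mul_assoc matrix_mul_lid matrix_mul_rid)
qed (use assms in simp)

text \<open>Oriented so that squares of cosines disappear, which brings trigonometric polynomials to
  a normal form.\<close>

lemma cos_mult_cos: "cos t * cos t = 1 - sin t * sin t" "cos t * (cos t * x) = x - sin t * (sin t * x)"
  for t x :: real
proof -
  show 1: "cos t * cos t = 1 - sin t * sin t"
    by (metis power2_eq_square sin_cos_squared_add2 add_diff_cancel_right')
  show "cos t * (cos t * x) = x - sin t * (sin t * x)"
    by (simp add: 1 left_diff_distrib flip: mult.assoc)
qed

lemma R3_mult_double:
  "R3 t *v v = vec5 (v $ 1) (cos t * v $ 2 - sin t * v $ 3) (sin t * v $ 2 + cos t * v $ 3)
     ((1 - 2 * (sin t * sin t)) * v $ 4 - 2 * (sin t * cos t) * v $ 5)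
     (2 * (sin t * cos t) * v $ 4 + (1 - 2 * (sin t * sin t)) * v $ 5)"
  by (simp add: R3_mult cos_double_sin sin_double power2_eq_square mult.assoc)

section \<open>The subgroup \<open>H_mu\<close> and its isotropy action\<close>

definition rot :: "real \<Rightarrow> real^2^2" where
  "rot t = vector [vector [cos t, sin t], vector [- sin t, cos t]]"

text \<open>Uniqueness for the linear differential equation of A by rotating back: rot (-t) ** A t
  has derivative zero.\<close>

lemma one_parameter_subgroup_rot:
  assumes "one_parameter_subgroup (**) (mat 1) (Eplus - Eminus) A"
  shows "A t = rot t"
proof -
  have A0: "A 0 = mat 1"
    using assms by (simp add: one_parameter_subgroup_def)
  have d: "((\<lambda>t. A t $ 1 $ j) has_real_derivative A t $ 2 $ j) (at t)"
    "((\<lambda>t. A t $ 2 $ j) has_real_derivative - A t $ 1 $ j) (at t)" for t j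
    using one_parameter_subgroup_matrix_deriv(1)[OF assms, of t]
    using exhaust_2[of j]
    by (auto simp: has_vector_derivative_vec_iff[where f = A] has_vector_derivative_vec_iff[where f = "\<lambda>t. A t $ i" for i]
      has_real_derivative_iff_has_vector_derivative forall_2 matrix_matrix_mult_def sum_2 Eplus_def Eminus_def)
  have "((\<lambda>t. cos t * A t $ 1 $ j - sin t * A t $ 2 $ j) has_real_derivative 0) (at t)"
    "((\<lambda>t. sin t * A t $ 1 $ j + cos t * A t $ 2 $ j) has_real_derivative 0) (at t)" for t j
    by (auto intro!: derivative_eq_intros d[THEN DERIV_cong])
  then have "cos t * A t $ 1 $ j - sin t * A t $ 2 $ j = A 0 $ 1 $ j"
    "sin t * A t $ 1 $ j + cos t * A t $ 2 $ j = A 0 $ 2 $ j" for j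
    using DERIV_isconst_all[of "\<lambda>t. cos t * A t $ 1 $ j - sin t * A t $ 2 $ j" t 0]
      DERIV_isconst_all[of "\<lambda>t. sin t * A t $ 1 $ j + cos t * A t $ 2 $ j" t 0] by simp_all
  then have e: "cos t * A t $ 1 $ j - sin t * A t $ 2 $ j = mat 1 $ 1 $ j"
    "sin t * A t $ 1 $ j + cos t * A t $ 2 $ j = mat 1 $ 2 $ j" for j
    by (simp_all add: A0)
  have "A t $ 1 $ j = cos t * mat 1 $ 1 $ j + sin t * mat 1 $ 2 $ j"
    "A t $ 2 $ j = - sin t * mat 1 $ 1 $ j + cos t * mat 1 $ 2 $ j" for j
    unfolding e[symmetric] by (simp_all add: algebra_simps cos_mult_cos)
  then show ?thesis
    by (simp add: vec_eq_iff forall_2 rot_def mat_def)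
qed

text \<open>The translation part satisfies b (s + t) = b s + A s *v b t with derivative 0 at 0, so
  it is constant. The component in the factor \<real> is left open, because \<open>Ad\<close> does
  not depend on it.\<close>

lemma H_mu_cases:
  assumes "h \<in> H_mu \<mu>"
  obtains a t where "h = (a, rot t, 0)"
proof -
  obtain c t where h: "h = c t" and c: "one_parameter_subgroup G_mult G_one (ebar0 \<mu>) c"
    using assms by (auto simp: H_mu_def)
  define A b where "A t = fst (snd (c t))" and "b t = snd (snd (c t))" for t
  have c_eq: "c t = (fst (c t), A t, b t)" for t by (simp add: A_def b_def)
  have c0: "A 0 = mat 1" "b 0 = 0"
    using c by (simp_all add: A_def b_def one_parameter_subgroup_def G_one_def)
  have add: "A (s + t) = A s ** A t" "b (s + t) = b s + A s *v b t" for s t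
  proof -
    have "c (s + t) = G_mult (c s) (c t)"
      using c by (simp add: one_parameter_subgroup_def)
    then show "A (s + t) = A s ** A t" "b (s + t) = b s + A s *v b t"
      using c_eq[of s] c_eq[of t] c_eq[of "s + t"] by (metis G_mult.simps Pair_inject)+
  qed
  have d: "(c has_vector_derivative ebar0 \<mu>) (at 0)"
    using c by (simp add: one_parameter_subgroup_def)
  have "(A has_vector_derivative Eplus - Eminus) (at 0)"
    using bounded_linear.has_vector_derivative[OF bounded_linear_fst_comp[OF bounded_linear_snd] d]
    by (simp add: A_def[abs_def] ebar0_def)
  then have "A t = rot t"
    by (intro one_parameter_subgroup_rot) (simp add: one_parameter_subgroup_def c0 add)
  have b: "(b has_vector_derivative 0) (at 0)"
    using bounded_linear.has_vector_derivative[OF bounded_linear_snd_comp[OF bounded_linear_snd] d]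
    by (simp add: b_def[abs_def] ebar0_def)
  have "(b has_vector_derivative 0) (at s)" for s
  proof -
    have "((\<lambda>x. x - s) has_vector_derivative 1) (at s)"
      by (auto intro!: derivative_eq_intros simp flip: has_real_derivative_iff_has_vector_derivative)
    then have "((\<lambda>x. b (x - s)) has_vector_derivative 0) (at s)"
      using vector_diff_chain_at[of "\<lambda>x. x - s" 1 s b 0] b by (simp add: o_def)
    from bounded_linear.has_vector_derivative[OF matrix_vector_mul_bounded_linear this, of "A s"]
    have "((\<lambda>x. b s + A s *v b (x - s)) has_vector_derivative 0) (at s)"
      by (auto intro!: derivative_eq_intros)
    then show ?thesis
      by (simp flip: add)
  qed
  then obtain z where "b s = z" for s
    using has_vector_derivative_zero_constant[of UNIV b] by auto
  then have "b t = 0" using c0 by metis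
  then show ?thesis
    using that c_eq[of t] h \<open>A t = rot t\<close> by metis
qed

text \<open>\<open>H_mu\<close> collects values of one-parameter subgroups, so an actual one has to
  be exhibited.\<close>

lemma G_one_in_H_mu: "G_one \<in> H_mu \<mu>"
proof -
  define c where "c t = (\<mu> * t, rot t, 0 :: real^2)" for t
  have "(rot has_vector_derivative Eplus - Eminus) (at 0)"
    by (rule has_vector_derivative_matrixI)
      (auto simp: has_vector_derivative_vec_iff rot_def matrix_vector_mult_def sum_2 forall_2 Eplus_def Eminus_def
        simp flip: has_real_derivative_iff_has_vector_derivative intro!: derivative_eq_intros)
  then have "(c has_vector_derivative ebar0 \<mu>) (at 0)"
    unfolding c_def ebar0_def
    by (auto intro!: has_vector_derivative_Pair derivative_eq_intros
        simp flip: has_real_derivative_iff_has_vector_derivative)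
  then have "one_parameter_subgroup G_mult G_one (ebar0 \<mu>) c"
    by (auto simp: one_parameter_subgroup_def c_def G_one_def rot_def vec_eq_iff forall_2 mat_def
      matrix_matrix_mult_def sum_2 cos_add sin_add algebra_simps)
  then have "c 0 \<in> H_mu \<mu>"
    by (auto simp: H_mu_def)
  moreover have "c 0 = G_one"
    by (simp add: c_def G_one_def rot_def vec_eq_iff forall_2 mat_def)
  ultimately show ?thesis by simp
qed

context Wir_metric
begin

lemma m_coord_frame: "m_coord \<mu> \<alpha> \<beta> \<gamma> (frame \<mu> \<alpha> \<beta> \<gamma> x) = x"
  and h_coord_frame: "h_coord \<mu> \<alpha> \<beta> \<gamma> (frame \<mu> \<alpha> \<beta> \<gamma> x) = 0"
  using coord_eq[OF pos, of 0 \<mu> x] by (simp_all add: frame_in_G_lie)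

lemma Ad_m_H_mu:
  assumes "h \<in> H_mu \<mu>"
  obtains t where "Ad_m \<mu> \<alpha> \<beta> \<gamma> h = R3 t"
proof -
  obtain a t where h: "h = (a, rot t, 0)" using H_mu_cases[OF assms] .
  note cs = cos_mult_cos[of t]
  have inv: "matrix_inv (rot t) = rot (- t)"
    by (rule matrix_inv_unique)
      (simp_all add: rot_def vec_eq_iff forall_2 mat_def matrix_matrix_mult_def sum_2 cs)
  have "Ad h (frame \<mu> \<alpha> \<beta> \<gamma> x) = frame \<mu> \<alpha> \<beta> \<gamma> (R3 t *v x)" for x
    unfolding h frame_eq Ad.simps inv R3_mult_double
    by (simp add: vec_eq_iff forall_2 matrix_matrix_mult_def matrix_vector_mult_def sum_2 rot_def
        add_divide_distrib diff_divide_distrib cs algebra_simps)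
  then have "Ad_m \<mu> \<alpha> \<beta> \<gamma> h = matrix (\<lambda>x. R3 t *v x)"
    by (simp add: Ad_m_def m_coord_frame)
  then show ?thesis using that by simp
qed

text \<open>For r = sqrt 3 q this is \<open>lc\<close> plus half of its own torsion. That equation
  matters for the torsion only: values in \<open>so3_ir\<close>, equivariance and holonomy are
  established for all parameters.\<close>

definition char_conn :: conn where
  "char_conn x = (- (sqrt 3 * q + p) * x $ 1) *\<^sub>R Y3 - (q * x $ 2) *\<^sub>R Y2 + (q * x $ 3) *\<^sub>R Y1"

lemma char_conn_mult: "char_conn x *v y =
  (- (sqrt 3 * q + p) * x $ 1) *\<^sub>R (Y3 *v y) - (q * x $ 2) *\<^sub>R (Y2 *v y) + (q * x $ 3) *\<^sub>R (Y1 *v y)"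
  unfolding char_conn_def matrix_vector_mult_add_rdistrib matrix_vector_mult_diff_rdistrib scaleR_mult_vec ..

lemma linear_char_conn: "linear char_conn"
  by (rule linearI) (simp_all add: char_conn_def algebra_simps)

lemma char_conn_so3_ir: "char_conn x \<in> so3_ir"
  unfolding so3_ir_def char_conn_def by (intro span_add span_diff span_scale) (simp_all add: span_base)

lemma invariant_char_conn: "invariant_connection \<mu> \<alpha> \<beta> \<gamma> char_conn"
  unfolding invariant_connection_def
proof (intro conjI ballI allI linear_char_conn)
  fix h x assume "h \<in> H_mu \<mu>"
  then obtain t where h: "Ad_m \<mu> \<alpha> \<beta> \<gamma> h = R3 t" using Ad_m_H_mu by blast
  have R: "R3 t ** R3 (-t) = mat 1" "R3 (-t) ** R3 t = mat 1"
    by (simp_all flip: R3_add)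
  \<comment> \<open>Equivariance in commuted form keeps the inverse out of the computation.\<close>
  have "char_conn (R3 t *v x) ** R3 t = R3 t ** char_conn x"
    by (rule matrix_eqI) (simp add: char_conn_mult Y1_mult Y2_mult Y3_mult R3_mult_double vec5_eq_iff
      cos_mult_cos algebra_simps flip: matrix_vector_mul_assoc)
  then have "char_conn (R3 t *v x) ** (R3 t ** R3 (-t)) = R3 t ** char_conn x ** R3 (-t)"
    by (simp add: matrix_mul_assoc)
  then show "char_conn (Ad_m \<mu> \<alpha> \<beta> \<gamma> h *v x) = Ad_m \<mu> \<alpha> \<beta> \<gamma> h ** char_conn x ** matrix_inv (Ad_m \<mu> \<alpha> \<beta> \<gamma> h)"
    by (simp add: h R matrix_inv_unique[OF R])
qed

end

text \<open>Skew torsion and metricity make the difference D skew in its two arguments, so D x kills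
  x. No nonzero element of \<open>so3_ir\<close> kills e_2, e_3, e_4 or e_5, hence D vanishes on
  these. Finally D e_1 kills e_1, and also e_2 by skewness, so it is zero.\<close>

lemma characteristic_unique:
  assumes "characteristic \<mu> \<alpha> \<beta> \<gamma> L" "characteristic \<mu> \<alpha> \<beta> \<gamma> L'"
  shows "L = L'"
proof -
  define D where "D x = L x - L' x" for x
  define t where "t x y z = torsion_form \<mu> \<alpha> \<beta> \<gamma> L x y z - torsion_form \<mu> \<alpha> \<beta> \<gamma> L' x y z" for x y z
  have t: "t x y z = (D x *v y) \<bullet> z - (D y *v x) \<bullet> z" for x y z
    by (simp add: t_def D_def torsion_form_def torsion_def matrix_vector_mult_diff_rdistrib
      inner_diff_left algebra_simps)
  have skew: "(D x *v y) \<bullet> z = - ((D x *v z) \<bullet> y)" for x y z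
  proof -
    have "(L x *v y) \<bullet> z + y \<bullet> (L x *v z) = 0" "(L' x *v y) \<bullet> z + y \<bullet> (L' x *v z) = 0"
      using assms by (auto simp: characteristic_def metric_conn_def)
    then show ?thesis
      by (simp add: D_def matrix_vector_mult_diff_rdistrib inner_diff_left inner_commute[of y])
  qed
  have t_skew: "t x y z = - t x z y" for x y z
  proof -
    have "torsion_form \<mu> \<alpha> \<beta> \<gamma> L x y z = - torsion_form \<mu> \<alpha> \<beta> \<gamma> L x z y"
      "torsion_form \<mu> \<alpha> \<beta> \<gamma> L' x y z = - torsion_form \<mu> \<alpha> \<beta> \<gamma> L' x z y"
      using assms unfolding characteristic_def by blast+
    then show ?thesis by (simp add: t_def)
  qed
  have D_skew: "D x *v y = - (D y *v x)" for x y
  proof -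
    have "(D x *v y) \<bullet> z = - ((D y *v x) \<bullet> z)" for z
      using t[of x y z] t[of y z x] t[of z x y] t[of x z y] t_skew[of x y z] t_skew[of y z x] t_skew[of z x y]
        t[of y x z] t[of z y x] skew[of x y z] skew[of y z x] skew[of z x y]
      by linarith
    then have "(D x *v y + D y *v x) \<bullet> (D x *v y + D y *v x) = 0"
      by (simp add: inner_add_left)
    then show ?thesis
      by (simp add: add_eq_0_iff)
  qed
  have "linear D"
    using assms by (auto simp: D_def[abs_def] characteristic_def intro: linear_compose_sub)
  have so: "D x \<in> so3_ir" for x
    using assms by (auto simp: D_def so3_ir_def characteristic_def intro: span_diff)
  define d1 d2 d3 d4 d5 where d: "d1 = D (axis 1 1)" "d2 = D (axis 2 1)" "d3 = D (axis 3 1)"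
    "d4 = D (axis 4 1)" "d5 = D (axis 5 1)"
  have diag: "D x *v x = 0" for x
    using D_skew[of x x] by (simp add: vec_eq_iff)
  have z: "d2 = 0" "d3 = 0" "d4 = 0" "d5 = 0"
    using diag[of "axis 2 1"] diag[of "axis 3 1"] diag[of "axis 4 1"] diag[of "axis 5 1"]
      so[of "axis 2 1"] so[of "axis 3 1"] so[of "axis 4 1"] so[of "axis 5 1"]
    by (auto simp: so3_ir_iff matrix_vector_mult_add_rdistrib scaleR_mult_vec Y1_mult Y2_mult Y3_mult
      vec5_eq_iff simp flip: d)
  obtain a b c where abc: "d1 = a *\<^sub>R Y1 + b *\<^sub>R Y2 + c *\<^sub>R Y3"
    using so[of "axis 1 1"] by (auto simp: so3_ir_iff simp flip: d)
  have "d1 *v axis 1 1 = 0" "d1 *v axis 2 1 = 0"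
    using diag[of "axis 1 1"] D_skew[of "axis 1 1" "axis 2 1"] z by (simp_all flip: d)
  then have "d1 = 0"
    by (simp add: abc matrix_vector_mult_add_rdistrib scaleR_mult_vec Y1_mult Y2_mult Y3_mult vec5_eq_iff)
  with z have "D (axis i 1) = 0" for i
    using exhaust_5[of i] by (auto simp: d)
  then have "D = (\<lambda>x. 0)"
    by (intro linear_eq_stdbasis[OF \<open>linear D\<close> linear_zero]) (auto simp: Basis_vec_def)
  then show ?thesis
    by (metis D_def eq_iff_diff_eq_0 ext)
qed

section \<open>Torsion of the characteristic connection and the values of \<mu>\<close>

context Wir_metric
begin

lemma torsion_char_conn:
  assumes r: "r = sqrt 3 * q"
  shows "torsion_form \<mu> \<alpha> \<beta> \<gamma> char_conn x y z = - (2 * sqrt 3 / sqrt \<gamma>) *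
    (wedge3 (axis 1 1) (axis 2 1) (axis 3 1) x y z + wedge3 (axis 1 1) (axis 4 1) (axis 5 1) x y z)"
proof -
  have q2: "2 * sqrt 3 / sqrt \<gamma> = 2 * sqrt 3 * q" by (simp add: q_def)
  show ?thesis
    unfolding q2
    by (simp add: torsion_form_def torsion_def char_conn_mult bracket_eq Y1_mult Y2_mult Y3_mult inner_5 wedge3_def det_3
      r algebra_simps)
qed

lemma characteristic_char_conn:
  assumes r: "r = sqrt 3 * q"
  shows "characteristic \<mu> \<alpha> \<beta> \<gamma> char_conn"
  unfolding characteristic_def
proof (intro conjI allI linear_char_conn char_conn_so3_ir)
  show "metric_conn char_conn"
    using skew_Y[OF char_conn_so3_ir] by (simp add: metric_conn_def)
  show "torsion_form \<mu> \<alpha> \<beta> \<gamma> char_conn x y z = - torsion_form \<mu> \<alpha> \<beta> \<gamma> char_conn y x z"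
    "torsion_form \<mu> \<alpha> \<beta> \<gamma> char_conn x y z = - torsion_form \<mu> \<alpha> \<beta> \<gamma> char_conn x z y" for x y z
    unfolding torsion_char_conn[OF r] wedge3_def det_3 by (simp_all add: algebra_simps)
qed

text \<open>In the direction e_3 the connection acts by q \<open>Y1\<close>. The e_1 component of
  \<open>Y1\<close> e_2 meets the summand e_1 \<and> e_4 \<and> e_5 of the torsion, and nothing
  cancels it.\<close>

lemma torsion_char_conn_not_parallel:
  assumes r: "r = sqrt 3 * q"
  shows "cov_deriv char_conn (torsion_form \<mu> \<alpha> \<beta> \<gamma> char_conn) (axis 3 1) (axis 2 1) (axis 4 1) (axis 5 1) \<noteq> 0"
  using q_pos pos
  by (simp add: cov_deriv_def torsion_char_conn[OF r] char_conn_mult Y1_mult wedge3_def det_3 inner_5)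

lemma divergence_torsion_char_conn:
  assumes r: "r = sqrt 3 * q"
  shows "divergence \<mu> \<alpha> \<beta> \<gamma> (torsion_form \<mu> \<alpha> \<beta> \<gamma> char_conn) x y = 0"
  unfolding divergence_def levi_civita_eq cov_deriv_def torsion_char_conn[OF r] sum_5
  by (simp add: lc_mult wedge3_def det_3 inner_5 algebra_simps)

text \<open>Cleared of denominators, r = sqrt 3 q reads b \<mu>^2 - a \<mu> + b = 0 with a = sqrt
  \<alpha> and b = sqrt (3 \<gamma>). Its discriminant \<alpha> - 12 \<gamma> is nonnegative by
  assumption.\<close>

lemma mu_root:
  assumes "\<alpha> \<ge> 12 * \<gamma>"
    and "\<mu> \<in> {(sqrt \<alpha> + sqrt (\<alpha> - 12 * \<gamma>)) / (2 * sqrt (3 * \<gamma>)),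
            (sqrt \<alpha> - sqrt (\<alpha> - 12 * \<gamma>)) / (2 * sqrt (3 * \<gamma>))}"
  shows "r = sqrt 3 * q"
proof -
  define a b d where abd: "a = sqrt \<alpha>" "b = sqrt (3 * \<gamma>)" "d = sqrt (\<alpha> - 12 * \<gamma>)"
  have b: "b > 0" "b * b = 3 * \<gamma>" and d: "d * d = a * a - 4 * (b * b)"
    using pos assms(1) by (simp_all add: abd)
  have "2 * b * \<mu> = a + d \<or> 2 * b * \<mu> = a - d"
    using assms(2) b by (auto simp flip: abd)
  \<comment> \<open>Squaring treats both signs of the root at once.\<close>
  then have "(2 * b * \<mu> - a) * (2 * b * \<mu> - a) = d * d"
    by auto
  then have "4 * b * (b * \<mu>\<^sup>2 + b - a * \<mu>) = 0"
    by (simp add: d algebra_simps power2_eq_square)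
  then have "b * \<mu>\<^sup>2 + b - a * \<mu> = 0"
    using b by (simp only: mult_eq_0_iff) simp
  then have "\<mu> * a = b * (1 + \<mu>\<^sup>2)"
    by (simp add: algebra_simps)
  moreover have "1 + \<mu>\<^sup>2 > 0" by (simp add: add_pos_nonneg)
  ultimately have "r = b / \<gamma>"
    by (simp add: r_def flip: abd)
  also have "\<dots> = sqrt 3 * q"
    using pos by (simp add: abd q_def real_sqrt_mult real_div_sqrt divide_simps)
  finally show ?thesis .
qed

end

section \<open>Holonomy\<close>

lemma matrix_mult_minus_left: "- A ** B = - (A ** B)"
  for A :: "real^'n^'m" and B :: "real^'k^'n"
  by (simp add: matrix_matrix_mult_def vec_eq_iff sum_negf)

lemma R_pi_mult:
  "R1 pi *v v = vec5 (v $ 1) (v $ 2) (- v $ 3) (v $ 4) (- v $ 5)" "R1 (- pi) *v v = R1 pi *v v"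
  "R2 pi *v v = vec5 (v $ 1) (- v $ 2) (v $ 3) (v $ 4) (- v $ 5)" "R2 (- pi) *v v = R2 pi *v v"
  by (simp_all add: R1_mult R2_mult Let_def vec5_eq_iff field_simps)

lemma R2_pi_conj: "R2 (- pi) ** (R1 (- a) ** (R2 pi ** B)) = R1 a ** B"
  and R1_pi_conj: "R1 (- pi) ** (R2 (- a) ** (R1 pi ** B)) = R2 a ** B"
  by (rule matrix_eqI;
      simp add: R_pi_mult R1_mult[of a] R1_mult[of "- a"] R2_mult[of a] R2_mult[of "- a"] Let_def vec5_eq_iff
      flip: matrix_vector_mul_assoc)+

context Wir_metric
begin

lemma conn_ext_so3_ir:
  assumes "\<And>x. L x \<in> so3_ir"
  shows "conn_ext \<mu> \<alpha> \<beta> \<gamma> L \<xi> \<in> so3_ir"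
  using assms unfolding conn_ext_def isotropy_eq[OF pos] Y3_def[symmetric] so3_ir_def
  by (intro span_add span_scale) (simp_all add: span_base)

lemma holonomy_subset_stab:
  assumes "\<And>x. L x \<in> so3_ir"
  shows "holonomy \<mu> \<alpha> \<beta> \<gamma> L \<subseteq> stab"
proof
  fix A assume "A \<in> holonomy \<mu> \<alpha> \<beta> \<gamma> L"
  then obtain g :: "real \<Rightarrow> amb" and P S \<xi> where A: "A = Ad_m \<mu> \<alpha> \<beta> \<gamma> (g 1) ** P 1" and g: "g 1 \<in> H_mu \<mu>"
    and P: "continuous_on {0..1} P" "P 0 = mat 1" and S: "finite S"
    and d: "\<And>t. t \<in> {0..1} - S \<Longrightarrow>
      (P has_vector_derivative - (conn_ext \<mu> \<alpha> \<beta> \<gamma> L (\<xi> t) ** P t)) (at t within {0..1::real})"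
    unfolding holonomy_def mem_Collect_eq by blast
  have "P 1 \<in> stab"
  proof (rule stab_ode[OF S P(1)])
    show "- conn_ext \<mu> \<alpha> \<beta> \<gamma> L (\<xi> t) \<in> so3_ir \<and>
      (P has_vector_derivative - conn_ext \<mu> \<alpha> \<beta> \<gamma> L (\<xi> t) ** P t) (at t within {0..1})"
      if "t \<in> {0..1} - S" for t
    proof
      show "- conn_ext \<mu> \<alpha> \<beta> \<gamma> L (\<xi> t) \<in> so3_ir"
        using conn_ext_so3_ir[OF assms] by (simp add: so3_ir_def span_neg)
      show "(P has_vector_derivative - conn_ext \<mu> \<alpha> \<beta> \<gamma> L (\<xi> t) ** P t) (at t within {0..1})"
        using d[OF that] by (simp add: matrix_mult_minus_left)
    qed
  qed (simp_all add: P)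
  moreover obtain t where "Ad_m \<mu> \<alpha> \<beta> \<gamma> (g 1) = R3 t"
    using Ad_m_H_mu[OF g] .
  ultimately show "A \<in> stab"
    by (simp add: A stab_mult R_in_stab)
qed

section \<open>Parallel transport along translations: a ball of radius 1 / \<kappa> rolling on a
  plane\<close>

definition \<kappa> where "\<kappa> = q * sqrt \<beta>"

definition conn_R2 :: "real^2 \<Rightarrow> real^5^5" where
  "conn_R2 w = (\<kappa> * w $ 1) *\<^sub>R Y1 - (\<kappa> * w $ 2) *\<^sub>R Y2"

lemma conn_ext_translation: "conn_ext \<mu> \<alpha> \<beta> \<gamma> char_conn (0, 0, w) = conn_R2 w"
proof -
  have *: "(0, 0, w) = frame \<mu> \<alpha> \<beta> \<gamma> (vec5 0 (sqrt \<beta> * w $ 2) (sqrt \<beta> * w $ 1) 0 0)"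
    using pos by (simp add: frame_eq vec_eq_iff forall_2)
  show ?thesis
    unfolding conn_ext_def * m_coord_frame h_coord_frame
    by (simp add: char_conn_def conn_R2_def \<kappa>_def mult.assoc)
qed

text \<open>\<open>Q\<close> is the parallel transport of \<open>char_conn\<close> along a path from \<open>0\<close> to \<open>w\<close> in the
  subgroup \<open>\<real>\<^sup>2\<close> of \<open>G\<close>.\<close>
definition transport :: "real^2 \<Rightarrow> real^5^5 \<Rightarrow> bool" where
  "transport w Q \<longleftrightarrow> (\<exists>\<sigma> P S D. \<sigma> piecewise_C1_differentiable_on {0..1} \<and> \<sigma> 0 = 0 \<and> \<sigma> 1 = w \<and>
     continuous_on {0..1} P \<and> P 0 = mat 1 \<and> P 1 = Q \<and> finite S \<and>
     (\<forall>t\<in>{0<..<1} - S. (\<sigma> has_vector_derivative D t) (at t) \<and>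
        (P has_vector_derivative - (conn_R2 (D t) ** P t)) (at t)))"

lemma transport_refl: "transport 0 (mat 1)"
  unfolding transport_def
proof (intro exI conjI ballI)
  show "(\<lambda>_. 0 :: real^2) piecewise_C1_differentiable_on {0..1}"
    by (intro C1_differentiable_imp_piecewise C1_differentiable_on_const)
  show "((\<lambda>_. 0 :: real^2) has_vector_derivative 0) (at t)" for t :: real
    by (rule has_vector_derivative_const)
  show "((\<lambda>_. mat 1 :: real^5^5) has_vector_derivative - (conn_R2 0 ** mat 1)) (at t)" for t :: real
    by (simp add: conn_R2_def)
qed auto

text \<open>A straight segment is appended by joining paths. Each half runs at double speed, and
  linearity of \<open>conn_R2\<close> in the velocity preserves the transport equation.\<close>

lemma transport_segment:
  assumes "transport w Q" and E0: "E 0 = mat 1"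
    and dE: "\<And>t. (E has_vector_derivative - (conn_R2 v ** E t)) (at t)"
  shows "transport (w + v) (E 1 ** Q)"
proof -
  obtain \<sigma> P S D where \<sigma>: "valid_path \<sigma>" "\<sigma> 0 = 0" "\<sigma> 1 = w"
    and P: "path P" "P 0 = mat 1" "P 1 = Q" and S: "finite S"
    and d: "\<And>t. t \<in> {0<..<1} - S \<Longrightarrow> (\<sigma> has_vector_derivative D t) (at t)"
      "\<And>t. t \<in> {0<..<1} - S \<Longrightarrow> (P has_vector_derivative - (conn_R2 (D t) ** P t)) (at t)"
    using assms(1) unfolding transport_def valid_path_def path_def by blast
  define \<tau> where "\<tau> t = w + t *\<^sub>R v" for t
  define F where "F t = E t ** Q" for t
  have d\<tau>: "(\<tau> has_vector_derivative v) (at t)" for t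
    unfolding \<tau>_def[abs_def] by (auto intro!: derivative_eq_intros)
  have dF: "(F has_vector_derivative - (conn_R2 v ** F t)) (at t)" for t
  proof -
    have "(F has_vector_derivative - (conn_R2 v ** E t) ** Q) (at t)"
      unfolding F_def[abs_def] by (rule bounded_linear.has_vector_derivative[OF bounded_linear_matrix_mult(1) dE])
    moreover have "- (conn_R2 v ** E t) ** Q = - (conn_R2 v ** F t)"
      by (simp add: F_def matrix_mult_minus_left matrix_mul_assoc)
    ultimately show ?thesis by simp
  qed
  have v\<tau>: "valid_path \<tau>"
    unfolding valid_path_def
    by (rule C1_differentiable_imp_piecewise) (auto simp: C1_differentiable_on_def intro!: exI[of _ "\<lambda>_. v"] d\<tau>)
  have pF: "path F"
    unfolding path_def by (meson dF continuous_at_imp_continuous_on has_vector_derivative_continuous)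
  \<comment> \<open>The joint at time 1/2 becomes a further exceptional point.\<close>
  define S' where "S' = insert (1/2) ((\<lambda>t. t / 2) ` S)"
  define D' where "D' t = (if t < 1/2 then 2 *\<^sub>R D (2 * t) else 2 *\<^sub>R v)" for t
  have conn_R2_scale: "- (conn_R2 (2 *\<^sub>R u) ** A) = 2 *\<^sub>R (- (conn_R2 u ** A))" for u and A :: "real^5^5"
  proof -
    have "conn_R2 (2 *\<^sub>R u) = 2 *\<^sub>R conn_R2 u"
      by (simp add: conn_R2_def scaleR_diff_right mult.left_commute)
    then show ?thesis
      by (simp add: matrix_matrix_mult_def vec_eq_iff sum_distrib_left mult.assoc)
  qed
  have join1: "((f +++ g) has_vector_derivative 2 *\<^sub>R f') (at t)"
    if "t < 1/2" and f: "(f has_vector_derivative f') (at (2 * t))"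
    for f g :: "real \<Rightarrow> 'x::real_normed_vector" and t f'
  proof -
    have "((\<lambda>t. 2 * t) has_vector_derivative 2) (at t)"
      by (auto intro!: derivative_eq_intros simp flip: has_real_derivative_iff_has_vector_derivative)
    from vector_diff_chain_at[OF this f]
    have "((\<lambda>t. f (2 * t)) has_vector_derivative 2 *\<^sub>R f') (at t)" by (simp add: o_def)
    then show ?thesis
      by (rule has_vector_derivative_transform_within_open[of _ _ _ "{..<1/2}"])
        (use that in \<open>auto simp: joinpaths_def\<close>)
  qed
  have join2: "((f +++ g) has_vector_derivative 2 *\<^sub>R f') (at t)"
    if "t > 1/2" and f: "(g has_vector_derivative f') (at (2 * t - 1))"
    for f g :: "real \<Rightarrow> 'x::real_normed_vector" and t f'
  proof -
    have "((\<lambda>t. 2 * t - 1) has_vector_derivative 2) (at t)"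
      by (auto intro!: derivative_eq_intros simp flip: has_real_derivative_iff_has_vector_derivative)
    from vector_diff_chain_at[OF this f]
    have "((\<lambda>t. g (2 * t - 1)) has_vector_derivative 2 *\<^sub>R f') (at t)" by (simp add: o_def)
    then show ?thesis
      by (rule has_vector_derivative_transform_within_open[of _ _ _ "{1/2<..}"])
        (use that in \<open>auto simp: joinpaths_def\<close>)
  qed
  have der: "((\<sigma> +++ \<tau>) has_vector_derivative D' t) (at t) \<and>
     ((P +++ F) has_vector_derivative - (conn_R2 (D' t) ** (P +++ F) t)) (at t)"
    if t: "t \<in> {0<..<1} - S'" for t
  proof (cases "t < 1/2")
    case True
    have "2 * t \<in> {0<..<1} - S"
      using t True imageI[of "2 * t" S "\<lambda>t. t / 2"] by (auto simp: S'_def)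
    note dd = d[OF this]
    have "(P +++ F) t = P (2 * t)" using True by (simp add: joinpaths_def)
    then show ?thesis
      using join1[OF True dd(1)] join1[OF True dd(2)] True by (simp add: D'_def conn_R2_scale)
  next
    case False
    then have t: "t > 1/2" using t by (auto simp: S'_def)
    have "(P +++ F) t = F (2 * t - 1)" using t by (simp add: joinpaths_def)
    then show ?thesis
      using join2[OF t d\<tau>] join2[OF t dF] t by (simp add: D'_def conn_R2_scale)
  qed
  show ?thesis
    unfolding transport_def
  proof (intro exI conjI ballI)
    show "\<sigma> +++ \<tau> piecewise_C1_differentiable_on {0..1}"
      using valid_path_join[OF \<sigma>(1) v\<tau>] \<sigma> by (simp add: valid_path_def pathfinish_def pathstart_def \<tau>_def)
    show "continuous_on {0..1} (P +++ F)"
      using path_join_imp[OF P(1) pF] P E0 by (simp add: path_def pathfinish_def pathstart_def F_def)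
    show "(\<sigma> +++ \<tau>) 0 = 0" "(\<sigma> +++ \<tau>) 1 = w + v" "(P +++ F) 0 = mat 1" "(P +++ F) 1 = E 1 ** Q"
      by (simp_all add: joinpaths_def \<sigma> P \<tau>_def F_def)
    show "finite S'" using S by (simp add: S'_def)
  qed (use der in auto)
qed

lemma \<kappa>_pos: "\<kappa> > 0"
  using q_pos pos by (simp add: \<kappa>_def)

text \<open>The displacement is negative because of the minus sign in the transport equation; for
  \<open>R2\<close> the minus sign in front of \<open>Y2\<close> in \<open>conn_R2\<close>
  compensates for it.\<close>

lemma transport_R1:
  assumes "transport w Q"
  shows "transport (w + axis 1 (- a / \<kappa>)) (R1 a ** Q)"
proof -
  have "((\<lambda>t. R1 (a * t)) has_vector_derivative - (conn_R2 (axis 1 (- a / \<kappa>)) ** R1 (a * t))) (at t)" for t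
  proof -
    have "((*) a has_vector_derivative a) (at t)"
      by (auto intro!: derivative_eq_intros simp flip: has_real_derivative_iff_has_vector_derivative)
    from vector_diff_chain_at[OF this one_parameter_subgroup_matrix_deriv(1)[OF one_parameter_subgroup_R(1)]]
    have "((\<lambda>t. R1 (a * t)) has_vector_derivative a *\<^sub>R (Y1 ** R1 (a * t))) (at t)" by (simp add: o_def)
    moreover have "a *\<^sub>R (Y1 ** R1 (a * t)) = - (conn_R2 (axis 1 (- a / \<kappa>)) ** R1 (a * t))"
      using \<kappa>_pos by (simp add: conn_R2_def axis_def matrix_matrix_mult_def vec_eq_iff sum_distrib_left sum_negf mult.assoc)
    ultimately show ?thesis by simp
  qed
  from transport_segment[OF assms _ this] show ?thesis by simp
qed

lemma transport_R2:
  assumes "transport w Q"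
  shows "transport (w + axis 2 (a / \<kappa>)) (R2 a ** Q)"
proof -
  have "((\<lambda>t. R2 (a * t)) has_vector_derivative - (conn_R2 (axis 2 (a / \<kappa>)) ** R2 (a * t))) (at t)" for t
  proof -
    have "((*) a has_vector_derivative a) (at t)"
      by (auto intro!: derivative_eq_intros simp flip: has_real_derivative_iff_has_vector_derivative)
    from vector_diff_chain_at[OF this one_parameter_subgroup_matrix_deriv(1)[OF one_parameter_subgroup_R(2)]]
    have "((\<lambda>t. R2 (a * t)) has_vector_derivative a *\<^sub>R (Y2 ** R2 (a * t))) (at t)" by (simp add: o_def)
    moreover have "a *\<^sub>R (Y2 ** R2 (a * t)) = - (conn_R2 (axis 2 (a / \<kappa>)) ** R2 (a * t))"
      using \<kappa>_pos by (simp add: conn_R2_def axis_def matrix_matrix_mult_def vec_eq_iff sum_distrib_left sum_negf mult.assoc)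
    ultimately show ?thesis by simp
  qed
  from transport_segment[OF assms _ this] show ?thesis by simp
qed

text \<open>The boundary of a rectangle of width \<open>pi / \<kappa>\<close>: conjugation by the half turn \<open>R2 pi\<close>
  inverts \<open>R1\<close>, so the contributions of the two opposite sides do not cancel but add up.\<close>
lemma transport_rectangle:
  assumes "transport w Q"
  shows "transport w (R1 (2 * a) ** Q)" "transport w (R2 (2 * a) ** Q)"
proof -
  have "transport (w + axis 1 (- a / \<kappa>) + axis 2 (pi / \<kappa>) + axis 1 (- (- a) / \<kappa>) + axis 2 (- pi / \<kappa>))
     (R2 (- pi) ** (R1 (- a) ** (R2 pi ** (R1 a ** Q))))"
    by (rule transport_R2[OF transport_R1[OF transport_R2[OF transport_R1[OF assms]]]])
  moreover have "w + axis 1 (- a / \<kappa>) + axis 2 (pi / \<kappa>) + axis 1 (- (- a) / \<kappa>) + axis 2 (- pi / \<kappa>) = w"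
    by (simp add: vec_eq_iff forall_2 axis_def)
  moreover have "R2 (- pi) ** (R1 (- a) ** (R2 pi ** (R1 a ** Q))) = R1 (a + a) ** Q"
    by (simp only: R2_pi_conj R1_add matrix_mul_assoc[symmetric])
  ultimately show "transport w (R1 (2 * a) ** Q)" by (simp only: mult_2)
  have "transport (w + axis 2 (a / \<kappa>) + axis 1 (- pi / \<kappa>) + axis 2 (- a / \<kappa>) + axis 1 (- (- pi) / \<kappa>))
     (R1 (- pi) ** (R2 (- a) ** (R1 pi ** (R2 a ** Q))))"
    by (rule transport_R1[OF transport_R2[OF transport_R1[OF transport_R2[OF assms]]]])
  moreover have "w + axis 2 (a / \<kappa>) + axis 1 (- pi / \<kappa>) + axis 2 (- a / \<kappa>) + axis 1 (- (- pi) / \<kappa>) = w"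
    by (simp add: vec_eq_iff forall_2 axis_def)
  moreover have "R1 (- pi) ** (R2 (- a) ** (R1 pi ** (R2 a ** Q))) = R2 (a + a) ** Q"
    by (simp only: R1_pi_conj R2_add matrix_mul_assoc[symmetric])
  ultimately show "transport w (R2 (2 * a) ** Q)" by (simp only: mult_2)
qed

lemma transport_R12:
  assumes "Q \<in> R12"
  shows "transport 0 Q"
  using assms
proof induction
  case (R1 A t)
  then show ?case using transport_rectangle(1)[of 0 A "t / 2"] by simp
next
  case (R2 A t)
  then show ?case using transport_rectangle(2)[of 0 A "t / 2"] by simp
qed (rule transport_refl)

text \<open>A closed path in the translations is a loop in G itself. It ends at the unit of
  \<open>H_mu\<close>, so the final correction by \<open>Ad_m\<close> is the identity.\<close>

lemma transport_holonomy:
  assumes "transport 0 Q"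
  shows "Q \<in> holonomy \<mu> \<alpha> \<beta> \<gamma> char_conn"
proof -
  obtain \<sigma> P S D where \<sigma>: "\<sigma> piecewise_C1_differentiable_on {0..1}" "\<sigma> 0 = 0" "\<sigma> 1 = 0"
    and P: "continuous_on {0..1} P" "P 0 = mat 1" "P 1 = Q" and S: "finite S"
    and d: "\<And>t. t \<in> {0<..<1} - S \<Longrightarrow> (\<sigma> has_vector_derivative D t) (at t)"
      "\<And>t. t \<in> {0<..<1} - S \<Longrightarrow> (P has_vector_derivative - (conn_R2 (D t) ** P t)) (at t)"
    using assms unfolding transport_def by blast
  define g :: "real \<Rightarrow> amb" where "g t = (0, mat 1, \<sigma> t)" for t
  have dg: "(g has_vector_derivative (0, 0, u)) (at t within T)" if "(\<sigma> has_vector_derivative u) (at t within T)" for t u T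
    unfolding g_def[abs_def]
    by (intro has_vector_derivative_Pair that has_vector_derivative_const)
  have g: "g piecewise_C1_differentiable_on {0..1}"
  proof -
    obtain S' D' where S': "finite S'" "continuous_on {0..1} \<sigma>" "continuous_on ({0..1} - S') D'"
      "\<And>x. x \<in> {0..1} - S' \<Longrightarrow> (\<sigma> has_vector_derivative D' x) (at x)"
      using \<sigma>(1) unfolding piecewise_C1_differentiable_on_def C1_differentiable_on_def by blast
    have "continuous_on {0..1} g"
      unfolding g_def[abs_def] by (intro continuous_intros S')
    moreover have "continuous_on ({0..1} - S') (\<lambda>t. (0 :: real, 0 :: real^2^2, D' t))"
      by (intro continuous_intros S')
    ultimately show ?thesis
      unfolding piecewise_C1_differentiable_on_def C1_differentiable_on_def
      by (intro conjI exI[of _ S'] exI[of _ "\<lambda>t. (0, 0, D' t)"] ballI dg S')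
  qed
  have g01: "g 0 = G_one" "g 1 = G_one"
    by (simp_all add: g_def G_one_def \<sigma>)
  have carrier: "g ` {0..1} \<subseteq> G_carrier"
    by (auto simp: g_def G_carrier_def)
  \<comment> \<open>\<open>transport\<close> gives two-sided derivatives at interior times only, so
    the endpoints 0 and 1 join the exceptional set.\<close>
  have ode: "(0, 0, D t) \<in> G_lie \<and>
      (g has_vector_derivative left_trans (g t) (0, 0, D t)) (at t within {0..1}) \<and>
      (P has_vector_derivative - (conn_ext \<mu> \<alpha> \<beta> \<gamma> char_conn (0, 0, D t) ** P t)) (at t within {0..1})"
    if "t \<in> {0..1} - (S \<union> {0, 1})" for t
  proof -
    have t: "t \<in> {0<..<1} - S" using that by auto
    have "left_trans (g t) (0, 0, D t) = (0, 0, D t)"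
      by (simp add: g_def)
    then show ?thesis
      using dg[OF has_vector_derivative_at_within[OF d(1)[OF t]]] has_vector_derivative_at_within[OF d(2)[OF t]]
      by (simp add: conn_ext_translation G_lie_def trace_def)
  qed
  have Ad: "Ad_m \<mu> \<alpha> \<beta> \<gamma> G_one = mat 1"
  proof -
    have "matrix_inv (mat 1) = (mat 1 :: real^2^2)"
      by (rule matrix_inv_unique) simp_all
    then have "Ad G_one \<xi> = \<xi>" for \<xi>
      by (cases \<xi>) (simp add: G_one_def)
    then show ?thesis
      by (intro matrix_eqI) (simp add: Ad_m_def m_coord_frame matrix_mult_vec[OF linear_ident])
  qed
  show ?thesis
    unfolding holonomy_def mem_Collect_eq
  proof (intro exI[of _ g] exI[of _ P] conjI)
    show "Q = Ad_m \<mu> \<alpha> \<beta> \<gamma> (g 1) ** P 1"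
      by (simp add: g01 Ad P)
    show "\<exists>S \<xi>. finite S \<and> (\<forall>t\<in>{0..1} - S. \<xi> t \<in> G_lie \<and>
        (g has_vector_derivative left_trans (g t) (\<xi> t)) (at t within {0..1}) \<and>
        (P has_vector_derivative - (conn_ext \<mu> \<alpha> \<beta> \<gamma> char_conn (\<xi> t) ** P t)) (at t within {0..1}))"
      using ode S by (intro exI[of _ "S \<union> {0, 1}"] exI[of _ "\<lambda>t. (0, 0, D t)"]) simp
  qed (simp_all add: g g01 carrier P G_one_in_H_mu)
qed

lemma holonomy_char_conn: "holonomy \<mu> \<alpha> \<beta> \<gamma> char_conn = SO3_ir"
proof
  show "holonomy \<mu> \<alpha> \<beta> \<gamma> char_conn \<subseteq> SO3_ir"
    unfolding SO3_ir_eq_stab by (rule holonomy_subset_stab[OF char_conn_so3_ir])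
  show "SO3_ir \<subseteq> holonomy \<mu> \<alpha> \<beta> \<gamma> char_conn"
    unfolding SO3_ir_eq_R12 using transport_R12 transport_holonomy by blast
qed

end

theorem theorem4p5:
  shows
   "(\<forall>\<alpha> \<beta> \<gamma> \<mu> :: real.
       \<alpha> > 0 \<and> \<beta> > 0 \<and> \<gamma> > 0 \<and> \<alpha> \<ge> 12 * \<gamma> \<and>
       \<mu> \<in> {(sqrt \<alpha> + sqrt (\<alpha> - 12 * \<gamma>)) / (2 * sqrt (3 * \<gamma>)),
            (sqrt \<alpha> - sqrt (\<alpha> - 12 * \<gamma>)) / (2 * sqrt (3 * \<gamma>))} \<longrightarrow>
       nearly_integrable \<mu> \<alpha> \<beta> \<gamma> \<and>
       (\<exists>\<Lambda>. invariant_connection \<mu> \<alpha> \<beta> \<gamma> \<Lambda> \<and>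
            characteristic \<mu> \<alpha> \<beta> \<gamma> \<Lambda> \<and>
            (\<forall>\<Lambda>'. characteristic \<mu> \<alpha> \<beta> \<gamma> \<Lambda>' \<longrightarrow> \<Lambda>' = \<Lambda>) \<and>
            torsion_form \<mu> \<alpha> \<beta> \<gamma> \<Lambda> =
              (\<lambda>x y z. - (2 * sqrt 3 / sqrt \<gamma>) *
                 (wedge3 (axis 1 1) (axis 2 1) (axis 3 1) x y z
                  + wedge3 (axis 1 1) (axis 4 1) (axis 5 1) x y z)) \<and>
            holonomy \<mu> \<alpha> \<beta> \<gamma> \<Lambda> = SO3_ir \<and>
            (\<exists>v x y z. cov_deriv \<Lambda> (torsion_form \<mu> \<alpha> \<beta> \<gamma> \<Lambda>) v x y z \<noteq> 0) \<and>
            (\<forall>x y. divergence \<mu> \<alpha> \<beta> \<gamma> (torsion_form \<mu> \<alpha> \<beta> \<gamma> \<Lambda>) x y = 0)))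
    \<and>
    (\<forall>\<alpha> \<beta> \<gamma> \<mu> :: real.
       \<alpha> > 0 \<and> \<beta> > 0 \<and> \<gamma> > 0 \<and> nearly_integrable \<mu> \<alpha> \<beta> \<gamma> \<longrightarrow>
       \<not> naturally_reductive \<mu> \<alpha> \<beta> \<gamma> \<and> \<not> einstein \<mu> \<alpha> \<beta> \<gamma>)"
proof (intro conjI allI impI)
  fix \<alpha> \<beta> \<gamma> \<mu> :: real
  assume *: "\<alpha> > 0 \<and> \<beta> > 0 \<and> \<gamma> > 0 \<and> \<alpha> \<ge> 12 * \<gamma> \<and>
       \<mu> \<in> {(sqrt \<alpha> + sqrt (\<alpha> - 12 * \<gamma>)) / (2 * sqrt (3 * \<gamma>)),
            (sqrt \<alpha> - sqrt (\<alpha> - 12 * \<gamma>)) / (2 * sqrt (3 * \<gamma>))}"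
  then interpret Wir_metric \<mu> \<alpha> \<beta> \<gamma> by unfold_locales auto
  have r: "r = sqrt 3 * q" using mu_root * by blast
  show "nearly_integrable \<mu> \<alpha> \<beta> \<gamma>"
    by (simp add: nearly_integrable_iff r)
  show "\<exists>\<Lambda>. invariant_connection \<mu> \<alpha> \<beta> \<gamma> \<Lambda> \<and>
            characteristic \<mu> \<alpha> \<beta> \<gamma> \<Lambda> \<and>
            (\<forall>\<Lambda>'. characteristic \<mu> \<alpha> \<beta> \<gamma> \<Lambda>' \<longrightarrow> \<Lambda>' = \<Lambda>) \<and>
            torsion_form \<mu> \<alpha> \<beta> \<gamma> \<Lambda> =
              (\<lambda>x y z. - (2 * sqrt 3 / sqrt \<gamma>) *
                 (wedge3 (axis 1 1) (axis 2 1) (axis 3 1) x y z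
                  + wedge3 (axis 1 1) (axis 4 1) (axis 5 1) x y z)) \<and>
            holonomy \<mu> \<alpha> \<beta> \<gamma> \<Lambda> = SO3_ir \<and>
            (\<exists>v x y z. cov_deriv \<Lambda> (torsion_form \<mu> \<alpha> \<beta> \<gamma> \<Lambda>) v x y z \<noteq> 0) \<and>
            (\<forall>x y. divergence \<mu> \<alpha> \<beta> \<gamma> (torsion_form \<mu> \<alpha> \<beta> \<gamma> \<Lambda>) x y = 0)"
  proof (intro exI[of _ char_conn] conjI allI impI)
    show "\<exists>v x y z. cov_deriv char_conn (torsion_form \<mu> \<alpha> \<beta> \<gamma> char_conn) v x y z \<noteq> 0"
      using torsion_char_conn_not_parallel[OF r] by blast
    show "L = char_conn" if "characteristic \<mu> \<alpha> \<beta> \<gamma> L" for L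
      by (rule characteristic_unique[OF that characteristic_char_conn[OF r]])
    show "torsion_form \<mu> \<alpha> \<beta> \<gamma> char_conn = (\<lambda>x y z. - (2 * sqrt 3 / sqrt \<gamma>) *
        (wedge3 (axis 1 1) (axis 2 1) (axis 3 1) x y z + wedge3 (axis 1 1) (axis 4 1) (axis 5 1) x y z))"
      by (intro ext torsion_char_conn[OF r])
  qed (simp_all only: invariant_char_conn characteristic_char_conn[OF r] holonomy_char_conn
      divergence_torsion_char_conn[OF r])
next
  fix \<alpha> \<beta> \<gamma> \<mu> :: real
  assume *: "\<alpha> > 0 \<and> \<beta> > 0 \<and> \<gamma> > 0 \<and> nearly_integrable \<mu> \<alpha> \<beta> \<gamma>"
  then interpret Wir_metric \<mu> \<alpha> \<beta> \<gamma> by unfold_locales auto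
  show "\<not> naturally_reductive \<mu> \<alpha> \<beta> \<gamma>"
    by (rule not_naturally_reductive)
  have "r = sqrt 3 * q"
    using * nearly_integrable_iff by blast
  then show "\<not> einstein \<mu> \<alpha> \<beta> \<gamma>"
    using q_pos by (intro not_einstein) simp
qed

end
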